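(* Let $\mathcal D$ be universal and suppose $\mathcal D\setminus\{0\}$ consists of a single block of $\mathcal D$ (equivalently, $x^{+}\le x+\min(\mathcal D\setminus\{0\})$ for every $x\in\mathcal D$ with $0<x<\max\mathcal D$). Then every $\mathrm M\in\mathfrak U_{\mathcal D}$ is indivisible: for every $\chi:M\to\{0,1\}$ there are $i\in\{0,1\}$ and a copy of $\mathrm M$ in $\mathrm M$ on which $\chi$ is constantly $i$.
   Context: $\mathcal D$ is a finite subset of $\mathbb R_{\ge0}$ containing $0$. $\mathfrak U_{\mathcal D}$ is the class of countable homogeneous metric spaces (every isometry between finite subspaces extends to an isometry of the space onto itself) with distance set exactly $\mathcal D$ into which every finite metric space with distances in $\mathcal D$ embeds isometrically; $\mathcal D$ is universal if this class is nonempty. A copy of $\mathrm M$ in $\mathrm M$ is the image of an isometric embedding of $\mathrm M$ into itself. For $r\in\mathcal D$ with $r<\max\mathcal D$, $r^{+}$ is the smallest element of $\mathcal D$ larger than $r$; for $r>0$, $r^{-}$ is the largest element of $\mathcal D$ smaller than $r$. A block of $\mathcal D$ is a nonempty set $\mathcal B=\{b_0<b_1<\dots<b_n\}\subseteq\mathcal D\setminus\{0\}$ such that $b_0>2b_0^{-}$, $b_{i+1}=b_i^{+}$ for all $i<n$, and $b_i+b_0\ge b_{i+1}$ for all $i<n$. *)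

theory Defs
  imports Complex_Main "HOL-Library.Countable_Set"
begin

definition metric_on :: "'a set \<Rightarrow> ('a \<Rightarrow> 'a \<Rightarrow> real) \<Rightarrow> bool" where
  "metric_on M d \<longleftrightarrow>
     (\<forall>x\<in>M. \<forall>y\<in>M. d x y \<ge> 0 \<and> (d x y = 0 \<longleftrightarrow> x = y) \<and> d x y = d y x) \<and>
     (\<forall>x\<in>M. \<forall>y\<in>M. \<forall>z\<in>M. d x z \<le> d x y + d y z)"

definition dist_set :: "'a set \<Rightarrow> ('a \<Rightarrow> 'a \<Rightarrow> real) \<Rightarrow> real set" where
  "dist_set M d = {d x y | x y. x \<in> M \<and> y \<in> M}"

definition isom_emb :: "'a set \<Rightarrow> ('a \<Rightarrow> 'a \<Rightarrow> real) \<Rightarrow> 'b set \<Rightarrow> ('b \<Rightarrow> 'b \<Rightarrow> real) \<Rightarrow> ('a \<Rightarrow> 'b) \<Rightarrow> bool" where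
  "isom_emb A dA B dB f \<longleftrightarrow> f ` A \<subseteq> B \<and> (\<forall>x\<in>A. \<forall>y\<in>A. dB (f x) (f y) = dA x y)"

definition homogeneous :: "'a set \<Rightarrow> ('a \<Rightarrow> 'a \<Rightarrow> real) \<Rightarrow> bool" where
  "homogeneous M d \<longleftrightarrow>
     (\<forall>A B f. finite A \<and> A \<subseteq> M \<and> B \<subseteq> M \<and> isom_emb A d M d f \<and> f ` A = B \<longrightarrow>
        (\<exists>g. isom_emb M d M d g \<and> g ` M = M \<and> (\<forall>x\<in>A. g x = f x)))"

text \<open>Membership in the class U_D. Finite metric spaces are represented (up to isometry)
  on finite subsets of nat.\<close>
definition in_U :: "real set \<Rightarrow> 'a set \<Rightarrow> ('a \<Rightarrow> 'a \<Rightarrow> real) \<Rightarrow> bool" where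
  "in_U D M d \<longleftrightarrow> metric_on M d \<and> countable M \<and> homogeneous M d \<and> dist_set M d = D \<and>
     (\<forall>(F::nat set) e. finite F \<and> metric_on F e \<and> dist_set F e \<subseteq> D \<longrightarrow>
        (\<exists>f. isom_emb F e M d f))"

text \<open>D is universal if U_D is nonempty (countable spaces represented on subsets of nat).\<close>
definition universal :: "real set \<Rightarrow> bool" where
  "universal D \<longleftrightarrow> (\<exists>(M::nat set) d. in_U D M d)"

definition dsucc :: "real set \<Rightarrow> real \<Rightarrow> real" where
  "dsucc D r = Min {x \<in> D. r < x}"

definition dpred :: "real set \<Rightarrow> real \<Rightarrow> real" where
  "dpred D r = Max {x \<in> D. x < r}"

definition is_block :: "real set \<Rightarrow> real set \<Rightarrow> bool" where
  "is_block D B \<longleftrightarrow> B \<noteq> {} \<and> B \<subseteq> D - {0} \<and>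
     Min B > 2 * dpred D (Min B) \<and>
     (\<forall>b\<in>B. b \<noteq> Max B \<longrightarrow> dsucc D b \<in> B \<and> b + Min B \<ge> dsucc D b)"

definition indivisible :: "'a set \<Rightarrow> ('a \<Rightarrow> 'a \<Rightarrow> real) \<Rightarrow> bool" where
  "indivisible M d \<longleftrightarrow>
     (\<forall>\<chi> :: 'a \<Rightarrow> nat. \<chi> ` M \<subseteq> {0, 1} \<longrightarrow>
        (\<exists>i\<in>{0, 1}. \<exists>f. isom_emb M d M d f \<and> (\<forall>x\<in>M. \<chi> (f x) = i)))"

end

theory Submission
  imports Defs "HOL-Library.FuncSet"
begin

text \<open>On \<open>D\<close> the truncated sum \<open>a \<oplus> b = max {x \<in> D. x \<le> a + b}\<close> is associative, because two triangles
  with a common side can be amalgamated; distances behave like elements of this ordered monoid, and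
  the block condition says that adding any positive distance moves at least one step up in \<open>D\<close>.
  A type is a one-point extension of a finite subspace. Call a colour class \<open>\<Gamma>\<close> large at a type of
  level \<open>0\<close> if it meets every extension of that type, and large at a type of level \<open>i + 1\<close> if every
  extension of level \<open>i + 1\<close> extends to a type of level \<open>i\<close> at which \<open>\<Gamma>\<close> is large (level \<open>i\<close> means:
  all prescribed distances have rank at least \<open>i\<close>). If \<open>\<Gamma>\<close> is not large at a type, its complement is
  large at some extension, so one of the two colours is large at a type of maximal level. For such a
  colour a copy of \<open>M\<close> is built point by point. With the finite part \<open>A\<close> one keeps a finite
  \<open>Y \<supseteq> A\<close> and, for every type over \<open>A\<close>, an extension to \<open>Y\<close> at which the colour is large for the
  level given by the smallest prescribed distance, coherently with the distances between types.
  To add a point, the types over the new finite part are treated as virtual points whose levels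
  are lowered one step at a time, highest first; by the block condition lowering one of
  them does not push the others below their own levels.\<close>

section \<open>Distance ranks as an ordered monoid, and types\<close>

text \<open>Distances are represented by their rank \<open>0, \<dots>, n\<close> in \<open>D\<close>. The operation is total on \<open>nat\<close>, with
  arguments above \<open>n\<close> acting as \<open>n\<close>, so only the unit law needs a bound.\<close>

locale block_space =
  fixes n :: nat and pl :: "nat \<Rightarrow> nat \<Rightarrow> nat" (infixl "\<oplus>" 65)
    and M :: "'a set" and d :: "'a \<Rightarrow> 'a \<Rightarrow> nat"
  assumes pl_comm: "i \<oplus> j = j \<oplus> i"
    and pl_assoc: "(i \<oplus> j) \<oplus> k = i \<oplus> (j \<oplus> k)"
    and pl_mono1: "i \<le> i' \<Longrightarrow> i \<oplus> j \<le> i' \<oplus> j"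
    and pl_0: "i \<le> n \<Longrightarrow> i \<oplus> 0 = i"
    and pl_le: "i \<oplus> j \<le> n"
    and pl_Suc: "i < n \<Longrightarrow> Suc i \<le> i \<oplus> 1"
    and d_le: "x \<in> M \<Longrightarrow> y \<in> M \<Longrightarrow> d x y \<le> n"
    and d_0: "x \<in> M \<Longrightarrow> y \<in> M \<Longrightarrow> d x y = 0 \<longleftrightarrow> x = y"
    and d_sym: "x \<in> M \<Longrightarrow> y \<in> M \<Longrightarrow> d x y = d y x"
    and d_tri: "x \<in> M \<Longrightarrow> y \<in> M \<Longrightarrow> z \<in> M \<Longrightarrow> d x z \<le> d x y \<oplus> d y z"
    and extension: "finite F \<Longrightarrow> F \<subseteq> M \<Longrightarrow> (\<And>x. x \<in> F \<Longrightarrow> 1 \<le> f x \<and> f x \<le> n) \<Longrightarrow>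
      (\<And>x y. x \<in> F \<Longrightarrow> y \<in> F \<Longrightarrow> f x \<le> f y \<oplus> d x y \<and> d x y \<le> f x \<oplus> f y) \<Longrightarrow>
      \<exists>z\<in>M. \<forall>x\<in>F. d z x = f x"
begin

lemma pl_mono: "i \<le> i' \<Longrightarrow> j \<le> j' \<Longrightarrow> i \<oplus> j \<le> i' \<oplus> j'"
  by (metis order_trans pl_comm pl_mono1)

lemma pl_left_comm: "i \<oplus> (j \<oplus> k) = j \<oplus> (i \<oplus> k)"
  by (metis pl_assoc pl_comm)

lemmas pl_ac = pl_assoc pl_comm pl_left_comm

lemma le_pl1: "i \<le> n \<Longrightarrow> i \<le> i \<oplus> j"
  by (metis pl_0 pl_mono order_refl zero_le)

lemma le_pl2: "i \<le> n \<Longrightarrow> i \<le> j \<oplus> i"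
  using le_pl1 pl_comm by simp

text \<open>The function lists the distances from a prospective point to \<open>F\<close>, as in a
  Katetov map. The lower bound 1 keeps that point outside \<open>F\<close>.\<close>

definition katetov :: "'a set \<Rightarrow> ('a \<Rightarrow> nat) \<Rightarrow> bool" where
  "katetov F f \<longleftrightarrow> (\<forall>x\<in>F. 1 \<le> f x \<and> f x \<le> n) \<and>
     (\<forall>x\<in>F. \<forall>y\<in>F. f x \<le> f y \<oplus> d x y \<and> d x y \<le> f x \<oplus> f y)"

text \<open>Over the empty set the level condition is vacuous, so the empty type has every level.
  The construction starts from it.\<close>

definition type_ge :: "nat \<Rightarrow> 'a set \<Rightarrow> ('a \<Rightarrow> nat) \<Rightarrow> bool" where
  "type_ge i F f \<longleftrightarrow> finite F \<and> F \<subseteq> M \<and> katetov F f \<and> (\<forall>x\<in>F. i \<le> f x)"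

definition extends :: "nat \<Rightarrow> 'a set \<Rightarrow> ('a \<Rightarrow> nat) \<Rightarrow> 'a set \<Rightarrow> ('a \<Rightarrow> nat) \<Rightarrow> bool" where
  "extends i F f G g \<longleftrightarrow> type_ge i G g \<and> F \<subseteq> G \<and> (\<forall>x\<in>F. g x = f x)"

section \<open>Largeness of a colour class and its dichotomy\<close>

primrec large :: "'a set \<Rightarrow> nat \<Rightarrow> 'a set \<Rightarrow> ('a \<Rightarrow> nat) \<Rightarrow> bool" where
  "large \<Gamma> 0 F f = (\<forall>G g. extends 0 F f G g \<longrightarrow> (\<exists>x\<in>\<Gamma>. \<forall>y\<in>G. d x y = g y))"
| "large \<Gamma> (Suc i) F f = (\<forall>G g. extends (Suc i) F f G g \<longrightarrow>
     (\<exists>H h. extends i G g H h \<and> large \<Gamma> i H h))"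

lemma extends_trans: "extends i F f G g \<Longrightarrow> extends j G g H h \<Longrightarrow> extends j F f H h"
  unfolding extends_def by (auto simp: subset_iff)

lemma extends_refl: "type_ge i F f \<Longrightarrow> extends i F f F f"
  unfolding extends_def by auto

lemma type_ge_mono: "type_ge i F f \<Longrightarrow> j \<le> i \<Longrightarrow> type_ge j F f"
  unfolding type_ge_def by force

lemma large_extends: "large \<Gamma> i F f \<Longrightarrow> extends i F f G g \<Longrightarrow> large \<Gamma> i G g"
  using extends_trans by (cases i) fastforce+

lemma type_realized:
  assumes "type_ge i F f" shows "\<exists>z\<in>M. \<forall>x\<in>F. d z x = f x"
  using assms extension[of F f] unfolding type_ge_def katetov_def by blast

text \<open>Failure of largeness yields an extension \<open>G\<close>, \<open>g\<close> that blocks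
  \<Gamma>. At level 0 no point of \<Gamma> realises \<open>g\<close>, while every further extension
  is realised somewhere in \<open>M\<close>, hence in the complement. At level \<open>Suc i\<close>
  no level \<open>i\<close> extension of \<open>g\<close> is large for \<Gamma>, so the induction
  hypothesis applies to each of them and makes the complement large above it.\<close>

lemma large_dichotomy:
  assumes "type_ge i F f" "\<not> large \<Gamma> i F f"
  shows "\<exists>G g. extends i F f G g \<and> large (M - \<Gamma>) i G g"
  using assms
proof (induction i arbitrary: F f)
  case 0
  then obtain G g where g: "extends 0 F f G g" "\<forall>x\<in>\<Gamma>. \<exists>y\<in>G. d x y \<noteq> g y"
    by auto
  have "\<exists>x\<in>M - \<Gamma>. \<forall>y\<in>H. d x y = h y" if h: "extends 0 G g H h" for H h
  proof -
    obtain z where z: "z \<in> M" "\<forall>x\<in>H. d z x = h x"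
      using h type_realized unfolding extends_def by blast
    then have "\<forall>x\<in>G. d z x = g x" using h unfolding extends_def by auto
    then show ?thesis using g z by blast
  qed
  then show ?case using g by auto
next
  case (Suc i)
  then obtain G g where g: "extends (Suc i) F f G g"
    and no: "\<And>H h. extends i G g H h \<Longrightarrow> \<not> large \<Gamma> i H h" by auto
  have "\<exists>K k. extends i H h K k \<and> large (M - \<Gamma>) i K k" if h: "extends (Suc i) G g H h" for H h
  proof -
    have 1: "type_ge i H h" using h unfolding extends_def by (auto intro: type_ge_mono)
    then have "extends i G g H h" using h unfolding extends_def by auto
    then show ?thesis using Suc.IH[OF 1] no by blast
  qed
  then show ?case using g by auto
qed

section \<open>Lowering the levels of virtual points\<close>

text \<open>Virtual points \<open>v \<in> V\<close> at distances \<open>c v\<close> from \<open>Y\<close>: \<open>\<delta> v w\<close> is the distance of two of them, and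
  the bound \<open>s v w\<close> ensures that two virtual points can still be realised at distance
  up to \<open>s v w\<close> from each other.\<close>

definition config :: "'a set \<Rightarrow> 'v set \<Rightarrow> ('v \<Rightarrow> 'v \<Rightarrow> nat) \<Rightarrow> ('v \<Rightarrow> 'v \<Rightarrow> nat) \<Rightarrow>
    'a set \<Rightarrow> ('v \<Rightarrow> 'a \<Rightarrow> nat) \<Rightarrow> ('v \<Rightarrow> nat) \<Rightarrow> bool" where
  "config \<Gamma> V \<delta> s Y c lv \<longleftrightarrow> finite Y \<and> Y \<subseteq> M \<and>
     (\<forall>v\<in>V. type_ge (lv v) Y (c v) \<and> large \<Gamma> (lv v) Y (c v)) \<and>
     (\<forall>v\<in>V. \<forall>w\<in>V. \<forall>y\<in>Y. c v y \<le> c w y \<oplus> \<delta> v w \<and> s v w \<le> c v y \<oplus> c w y)"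

text \<open>Largeness of \<open>h\<close> at level \<open>Suc j\<close> supplies an extension
  \<open>u\<close> of \<open>c h\<close>, of level \<open>j\<close>, on a larger base
  \<open>G\<close>. The other virtual points must follow to \<open>G\<close>. A path through
  \<open>h\<close> to a new base point has length at least \<open>j \<oplus> \<delta> h k\<close>;
  \<open>lvl\<close> says that this does not undercut the level of \<open>k\<close>, and
  \<open>sums\<close> says that two such paths respect the bound \<open>s\<close>.\<close>

lemma lower_step:
  fixes V :: "'v set"
  assumes cfg: "config \<Gamma> V \<delta> s Y c lv"
    and h: "h \<in> V" "lv h = Suc j"
    and \<delta>0: "\<delta> h h = 0" and \<delta>sym: "\<And>v w. v \<in> V \<Longrightarrow> w \<in> V \<Longrightarrow> \<delta> v w = \<delta> w v"
    and \<delta>tri: "\<And>u v w. u \<in> V \<Longrightarrow> v \<in> V \<Longrightarrow> w \<in> V \<Longrightarrow> \<delta> u w \<le> \<delta> u v \<oplus> \<delta> v w"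
    and lvl: "\<And>k. k \<in> V \<Longrightarrow> k \<noteq> h \<Longrightarrow> lv k \<le> j \<oplus> \<delta> h k"
    and sums: "\<And>k k'. k \<in> V \<Longrightarrow> k' \<in> V \<Longrightarrow> s k k' \<le> (j \<oplus> \<delta> h k) \<oplus> (j \<oplus> \<delta> h k')"
  shows "\<exists>G c'. Y \<subseteq> G \<and> (\<forall>v\<in>V. \<forall>y\<in>Y. c' v y = c v y) \<and> config \<Gamma> V \<delta> s G c' (lv(h := j))"
proof -
  have finY: "finite Y" and YM: "Y \<subseteq> M"
    and tc: "\<And>v. v \<in> V \<Longrightarrow> type_ge (lv v) Y (c v)"
    and lc: "\<And>v. v \<in> V \<Longrightarrow> large \<Gamma> (lv v) Y (c v)"
    and c\<delta>: "\<And>v w y. v \<in> V \<Longrightarrow> w \<in> V \<Longrightarrow> y \<in> Y \<Longrightarrow> c v y \<le> c w y \<oplus> \<delta> v w"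
    and cs: "\<And>v w y. v \<in> V \<Longrightarrow> w \<in> V \<Longrightarrow> y \<in> Y \<Longrightarrow> s v w \<le> c v y \<oplus> c w y"
    using cfg unfolding config_def by blast+
  have cn: "1 \<le> c v y" "c v y \<le> n" "lv v \<le> c v y" if "v \<in> V" "y \<in> Y" for v y
    using tc that unfolding type_ge_def katetov_def by auto
  have c1: "c v y \<le> c v z \<oplus> d y z" "d y z \<le> c v y \<oplus> c v z" if "v \<in> V" "y \<in> Y" "z \<in> Y" for v y z
    using tc that unfolding type_ge_def katetov_def by auto
  obtain G u where u: "extends j Y (c h) G u" and lu: "large \<Gamma> j G u"
    using lc[OF h(1)] extends_refl[OF tc[OF h(1)]] h(2) by fastforce
  have finG: "finite G" and GM: "G \<subseteq> M" and YG: "Y \<subseteq> G" and tu: "type_ge j G u"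
    and uc: "\<And>y. y \<in> Y \<Longrightarrow> u y = c h y"
    using u unfolding extends_def type_ge_def by auto
  have un: "1 \<le> u y" "u y \<le> n" "j \<le> u y" if "y \<in> G" for y
    using tu that unfolding type_ge_def katetov_def by auto
  have u1: "u y \<le> u z \<oplus> d y z" "d y z \<le> u y \<oplus> u z" if "y \<in> G" "z \<in> G" for y z
    using tu that unfolding type_ge_def katetov_def by auto
  \<comment> \<open>\<open>c'\<close> is the shortest-path distance in the free amalgam over \<open>Y\<close> and the virtual point \<open>h\<close>.\<close>
  define P where "P k y = insert (u y \<oplus> \<delta> h k) ((\<lambda>z. c k z \<oplus> d z y) ` Y)" for k y
  define c' where "c' k y = Min (P k y)" for k y
  have finP: "finite (P k y)" "P k y \<noteq> {}" for k y using finY by (auto simp: P_def)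
  have c'_in: "c' k y \<in> P k y" for k y unfolding c'_def using finP by (rule Min_in)
  have c'_u: "c' k y \<le> u y \<oplus> \<delta> h k" for k y
    unfolding c'_def by (rule Min_le) (auto simp: P_def finY)
  have c'_z: "c' k y \<le> c k z \<oplus> d z y" if "z \<in> Y" for k y z
    unfolding c'_def by (rule Min_le) (auto simp: P_def finY that)
  have c'_cases: "c' k y = u y \<oplus> \<delta> h k \<or> (\<exists>z\<in>Y. c' k y = c k z \<oplus> d z y)" for k y
    using c'_in[of k y] by (auto simp: P_def)
  have c'_ge: "b \<le> c' k y" if "b \<le> u y \<oplus> \<delta> h k" "\<And>z. z \<in> Y \<Longrightarrow> b \<le> c k z \<oplus> d z y" for b k y
    using c'_cases[of k y] that by auto
  have d\<^sub>0: "d y y = 0" if "y \<in> M" for y using d_0 that by auto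
  \<comment> \<open>Nothing changes on \<open>Y\<close>: the path through \<open>h\<close> is no
    shortcut by coherence of \<open>c\<close> with \<delta>, and a path through another
    \<open>z\<close> in \<open>Y\<close> is none because \<open>c k\<close> is a type.\<close>
  have c'_Y: "c' k y = c k y" if "k \<in> V" "y \<in> Y" for k y
  proof (rule antisym)
    show "c' k y \<le> c k y" using c'_z[of y k y] that YM cn[OF that] pl_0 d\<^sub>0[of y] by auto
    show "c k y \<le> c' k y"
    proof (rule c'_ge)
      show "c k y \<le> u y \<oplus> \<delta> h k" using c\<delta>[OF that(1) h(1) that(2)] uc[OF that(2)] \<delta>sym[OF h(1) that(1)] by simp
      show "c k y \<le> c k z \<oplus> d z y" if "z \<in> Y" for z
        using c1(1)[OF \<open>k \<in> V\<close> \<open>y \<in> Y\<close> that] d_sym[of y z] \<open>y \<in> Y\<close> that YM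
        by (simp add: subset_iff)
    qed
  qed
  have c'_h: "c' h y = u y" if "y \<in> G" for y
  proof (rule antisym)
    show "c' h y \<le> u y" using c'_u[of h y] \<delta>0 pl_0 un[OF that] by simp
    show "u y \<le> c' h y"
    proof (rule c'_ge)
      show "u y \<le> u y \<oplus> \<delta> h h" using \<delta>0 pl_0 un[OF that] by simp
      show "u y \<le> c h z \<oplus> d z y" if "z \<in> Y" for z
        using u1(1)[of y z] uc[OF that] that \<open>y \<in> G\<close> YG d_sym[of y z] GM
        by (simp add: subset_iff)
    qed
  qed
  have c'_lip: "c' k y \<le> c' k y' \<oplus> d y y'" if "k \<in> V" "y \<in> G" "y' \<in> G" for k y y'
  proof -
    consider "c' k y' = u y' \<oplus> \<delta> h k" | z where "z \<in> Y" "c' k y' = c k z \<oplus> d z y'"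
      using c'_cases by blast
    then show ?thesis
    proof cases
      case 1
      have "c' k y \<le> u y \<oplus> \<delta> h k" by (rule c'_u)
      also have "\<dots> \<le> (u y' \<oplus> d y y') \<oplus> \<delta> h k" by (intro pl_mono u1 that order_refl)
      finally show ?thesis using 1 by (simp add: pl_ac)
    next
      case 2
      have "c' k y \<le> c k z \<oplus> d z y" using 2 by (intro c'_z)
      also have "\<dots> \<le> c k z \<oplus> (d z y' \<oplus> d y' y)"
        using that 2 YM GM by (intro pl_mono order_refl d_tri) auto
      also have "d y' y = d y y'" using that GM by (intro d_sym) auto
      finally show ?thesis using 2 by (simp add: pl_ac)
    qed
  qed
  \<comment> \<open>For \<open>z\<close> in \<open>Y\<close> the value \<open>u z\<close> is
    \<open>c h z\<close>, so the route from \<open>y\<close> to \<open>z\<close> may go through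
    \<open>h\<close> and then \<open>k\<close>. This settles the mixed case of
    \<open>c'_sum\<close>, where one path uses \<open>h\<close> and the other uses
    \<open>Y\<close>.\<close>
  have uz: "d y z \<le> (u y \<oplus> \<delta> h k) \<oplus> c k z" if "k \<in> V" "y \<in> G" "z \<in> Y" for k y z
  proof -
    have "d y z \<le> u y \<oplus> u z" using that YG by (intro u1) auto
    also have "u z \<le> c k z \<oplus> \<delta> h k" using uc that c\<delta>[OF h(1) that(1) that(3)] by simp
    finally show ?thesis by (simp add: pl_ac pl_mono)
  qed
  have c'_sum: "d y y' \<le> c' k y \<oplus> c' k y'" if k: "k \<in> V" and y: "y \<in> G" "y' \<in> G" for k y y'
  proof -
    have A: "d y y' \<le> (u y \<oplus> \<delta> h k) \<oplus> (c k z \<oplus> d z y')" if "y \<in> G" "y' \<in> G" "z \<in> Y" for y y' z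
    proof -
      have "d y y' \<le> d y z \<oplus> d z y'" using that YM GM by (intro d_tri) auto
      also have "\<dots> \<le> ((u y \<oplus> \<delta> h k) \<oplus> c k z) \<oplus> d z y'" using uz k that by (intro pl_mono) auto
      finally show ?thesis by (simp add: pl_ac)
    qed
    consider "c' k y = u y \<oplus> \<delta> h k" "c' k y' = u y' \<oplus> \<delta> h k"
      | z where "c' k y = u y \<oplus> \<delta> h k" "z \<in> Y" "c' k y' = c k z \<oplus> d z y'"
      | z where "c' k y' = u y' \<oplus> \<delta> h k" "z \<in> Y" "c' k y = c k z \<oplus> d z y"
      | z z' where "z \<in> Y" "c' k y = c k z \<oplus> d z y" "z' \<in> Y" "c' k y' = c k z' \<oplus> d z' y'"
      using c'_cases[of k y] c'_cases[of k y'] by blast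
    then show ?thesis
    proof cases
      case 1
      have "d y y' \<le> u y \<oplus> u y'" using y by (intro u1)
      also have "\<dots> \<le> (u y \<oplus> \<delta> h k) \<oplus> (u y' \<oplus> \<delta> h k)" using y un by (intro pl_mono le_pl1)
      finally show ?thesis using 1 by simp
    next
      case 2
      then show ?thesis using A[OF y] by simp
    next
      case 3
      have "d y y' = d y' y" using y GM by (intro d_sym) auto
      also have "\<dots> \<le> c' k y' \<oplus> c' k y" using 3 A[of y' y z] y by simp
      finally show ?thesis by (simp add: pl_comm)
    next
      case 4
      have "d y y' \<le> d y z \<oplus> d z y'" using y 4 YM GM by (intro d_tri) auto
      also have "\<dots> \<le> d y z \<oplus> (d z z' \<oplus> d z' y')"
        using y 4 YM GM by (intro pl_mono order_refl d_tri) auto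
      also have "\<dots> \<le> d y z \<oplus> ((c k z \<oplus> c k z') \<oplus> d z' y')"
        using k 4 by (intro pl_mono order_refl c1)
      also have "d y z = d z y" using y 4 YM GM by (intro d_sym) auto
      finally show ?thesis using 4 by (simp add: pl_ac)
    qed
  qed
  have c'_\<delta>: "c' k y \<le> c' k' y \<oplus> \<delta> k k'" if k: "k \<in> V" "k' \<in> V" and y: "y \<in> G" for k k' y
  proof -
    consider "c' k' y = u y \<oplus> \<delta> h k'" | z where "z \<in> Y" "c' k' y = c k' z \<oplus> d z y"
      using c'_cases by blast
    then show ?thesis
    proof cases
      case 1
      have "c' k y \<le> u y \<oplus> \<delta> h k" by (rule c'_u)
      also have "\<dots> \<le> u y \<oplus> (\<delta> h k' \<oplus> \<delta> k' k)" using k h by (intro pl_mono \<delta>tri order_refl)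
      also have "\<delta> k' k = \<delta> k k'" using k by (rule \<delta>sym[rotated])
      finally show ?thesis using 1 by (simp add: pl_ac)
    next
      case 2
      have "c' k y \<le> c k z \<oplus> d z y" using 2 by (intro c'_z)
      also have "\<dots> \<le> (c k' z \<oplus> \<delta> k k') \<oplus> d z y" using 2 k by (intro pl_mono c\<delta> order_refl)
      finally show ?thesis using 2 by (simp add: pl_ac)
    qed
  qed
  \<comment> \<open>If both shortest paths use \<open>h\<close>, then \<open>sums\<close> applies
    because \<open>u\<close> is at least \<open>j\<close>. If one of them passes through
    \<open>z\<close> in \<open>Y\<close>, the old bound at \<open>z\<close> carries over to
    \<open>y\<close>, since the other function is Lipschitz along \<open>d z y\<close>.\<close>
  have c'_s: "s k k' \<le> c' k y \<oplus> c' k' y" if k: "k \<in> V" "k' \<in> V" and y: "y \<in> G" for k k' y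
  proof -
    have A: "c k1 z \<oplus> c k2 z \<le> (c k1 z \<oplus> d z y) \<oplus> c' k2 y" if "k1 \<in> V" "k2 \<in> V" "z \<in> Y" for k1 k2 z
    proof -
      have "c k2 z \<le> c' k2 y \<oplus> d z y" using c'_lip[of k2 z y] c'_Y that y YG by auto
      then have "c k1 z \<oplus> c k2 z \<le> c k1 z \<oplus> (c' k2 y \<oplus> d z y)" by (intro pl_mono order_refl)
      then show ?thesis by (simp add: pl_ac)
    qed
    consider "c' k y = u y \<oplus> \<delta> h k" "c' k' y = u y \<oplus> \<delta> h k'"
      | z where "z \<in> Y" "c' k y = c k z \<oplus> d z y"
      | z where "z \<in> Y" "c' k' y = c k' z \<oplus> d z y"
      using c'_cases[of k y] c'_cases[of k' y] by blast
    then show ?thesis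
    proof cases
      case 1
      have "s k k' \<le> (j \<oplus> \<delta> h k) \<oplus> (j \<oplus> \<delta> h k')" using k by (rule sums)
      also have "\<dots> \<le> (u y \<oplus> \<delta> h k) \<oplus> (u y \<oplus> \<delta> h k')" using un y by (intro pl_mono order_refl)
      finally show ?thesis using 1 by simp
    next
      case 2
      then show ?thesis using A[of k k' z] cs[of k k' z] k by simp
    next
      case 3
      then show ?thesis using A[of k' k z] cs[of k k' z] k by (simp add: pl_comm)
    qed
  qed
  have c'_rng: "1 \<le> c' k y" "c' k y \<le> n" if "k \<in> V" "y \<in> G" for k y
  proof -
    show "1 \<le> c' k y"
    proof (rule c'_ge)
      have "u y \<le> u y \<oplus> \<delta> h k" using un that by (intro le_pl1)
      then show "1 \<le> u y \<oplus> \<delta> h k" using un[OF that(2)] by simp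
      show "1 \<le> c k z \<oplus> d z y" if "z \<in> Y" for z
        using cn[OF \<open>k \<in> V\<close> that] le_pl1[of "c k z" "d z y"] by simp
    qed
    show "c' k y \<le> n" using c'_u[of k y] pl_le order_trans by blast
  qed
  have c'_lv: "(lv(h := j)) k \<le> c' k y" if k: "k \<in> V" and y: "y \<in> G" for k y
  proof (cases "k = h")
    case True
    then show ?thesis using c'_h un y by simp
  next
    case False
    have "lv k \<le> c' k y"
    proof (rule c'_ge)
      show "lv k \<le> u y \<oplus> \<delta> h k"
        using lvl[OF k False] pl_mono[OF un(3)[OF y] order_refl, of "\<delta> h k"] by simp
      show "lv k \<le> c k z \<oplus> d z y" if "z \<in> Y" for z
        using cn[OF k that] le_pl1[of "c k z" "d z y"] by simp
    qed
    then show ?thesis using False by simp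
  qed
  have T: "type_ge ((lv(h := j)) k) G (c' k)" if "k \<in> V" for k
    unfolding type_ge_def katetov_def using finG GM c'_rng c'_lip c'_sum c'_lv that by blast
  \<comment> \<open>For \<open>h\<close> largeness at level \<open>j\<close> comes from the choice
    of \<open>u\<close>. For the others the level is unchanged and largeness is inherited by the
    extension from \<open>Y\<close> to \<open>G\<close>.\<close>
  have L: "large \<Gamma> ((lv(h := j)) k) G (c' k)" if k: "k \<in> V" for k
  proof (cases "k = h")
    case True
    have "extends j G u G (c' h)"
      unfolding extends_def using T[OF h(1)] c'_h by simp
    then show ?thesis using lu large_extends True by simp
  next
    case False
    have "extends (lv k) Y (c k) G (c' k)"
      unfolding extends_def using T[OF k] c'_Y[OF k] YG False by simp
    then show ?thesis using lc[OF k] large_extends False by simp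
  qed
  have "config \<Gamma> V \<delta> s G c' (lv(h := j))"
    unfolding config_def using finG GM T L c'_\<delta> c'_s by blast
  then show ?thesis using YG c'_Y by blast
qed


text \<open>Induction on the total excess of \<open>lv\<close> over \<open>tgt\<close>; each use of
  \<open>lower_step\<close> removes one unit at one point. The bound \<open>sums\<close> is asked
  only where \<open>tgt u < n\<close>: a point that gets lowered satisfies this, because
  \<open>lv\<close> is at most \<open>n\<close>.\<close>

lemma lower_all:
  fixes V :: "'v set"
  assumes finV: "finite V" and "config \<Gamma> V \<delta> s Y c lv"
    and "\<And>v. v \<in> V \<Longrightarrow> tgt v \<le> lv v \<and> lv v \<le> n"
    and \<delta>0: "\<And>v. v \<in> V \<Longrightarrow> \<delta> v v = 0"
    and \<delta>pos: "\<And>v w. v \<in> V \<Longrightarrow> w \<in> V \<Longrightarrow> v \<noteq> w \<Longrightarrow> 0 < \<delta> v w"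
    and \<delta>sym: "\<And>v w. v \<in> V \<Longrightarrow> w \<in> V \<Longrightarrow> \<delta> v w = \<delta> w v"
    and \<delta>tri: "\<And>u v w. u \<in> V \<Longrightarrow> v \<in> V \<Longrightarrow> w \<in> V \<Longrightarrow> \<delta> u w \<le> \<delta> u v \<oplus> \<delta> v w"
    and lip: "\<And>v w. v \<in> V \<Longrightarrow> w \<in> V \<Longrightarrow> tgt w \<le> tgt v \<oplus> \<delta> v w"
    and sums: "\<And>u v w. u \<in> V \<Longrightarrow> v \<in> V \<Longrightarrow> w \<in> V \<Longrightarrow> tgt u < n \<Longrightarrow>
       s v w \<le> (tgt u \<oplus> \<delta> u v) \<oplus> (tgt u \<oplus> \<delta> u w)"
  shows "\<exists>G c'. Y \<subseteq> G \<and> (\<forall>v\<in>V. \<forall>y\<in>Y. c' v y = c v y) \<and> config \<Gamma> V \<delta> s G c' tgt"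
  using assms(2,3)
proof (induction "\<Sum>v\<in>V. lv v - tgt v" arbitrary: Y c lv rule: less_induct)
  case less
  show ?case
  proof (cases "\<exists>v\<in>V. tgt v < lv v")
    case False
    then have "lv v = tgt v" if "v \<in> V" for v using less.prems(2) that by force
    then have "config \<Gamma> V \<delta> s Y c tgt" using less.prems(1) unfolding config_def by auto
    then show ?thesis by blast
  next
    case True
    \<comment> \<open>Highest first: every virtual point strictly above \<open>h\<close> already has its target level.\<close>
    define W where "W = {v \<in> V. tgt v < lv v}"
    have W: "finite W" "W \<noteq> {}" using True finV by (auto simp: W_def)
    then have "Max (lv ` W) \<in> lv ` W" by (intro Max_in) auto
    then obtain h where hW: "h \<in> W" and hM: "lv h = Max (lv ` W)" by auto
    have hmax: "lv k \<le> lv h" if "k \<in> W" for k unfolding hM using that W by auto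
    have h: "h \<in> V" "tgt h < lv h" using hW by (auto simp: W_def)
    then obtain j where j: "lv h = Suc j" by (cases "lv h") auto
    have tj: "tgt h \<le> j" using h j by simp
    have jn: "j < n" using less.prems(2)[OF h(1)] j by simp
    \<comment> \<open>A point of level at most \<open>Suc j\<close> is safe because its distance
      from \<open>h\<close> is positive and adding it to \<open>j\<close> gains at least one rank. A
      higher point is already at its target, and targets are Lipschitz by
      \<open>lip\<close>.\<close>
    have lvl: "lv k \<le> j \<oplus> \<delta> h k" if k: "k \<in> V" "k \<noteq> h" for k
    proof (cases "lv k \<le> Suc j")
      case True
      also have "Suc j \<le> j \<oplus> 1" using jn by (rule pl_Suc)
      also have "\<dots> \<le> j \<oplus> \<delta> h k" using \<delta>pos[of h k] k h by (intro pl_mono) auto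
      finally show ?thesis .
    next
      case False
      then have "k \<notin> W" using hmax j by fastforce
      then have "lv k = tgt k" using k less.prems(2)[of k] by (auto simp: W_def)
      also have "\<dots> \<le> tgt h \<oplus> \<delta> h k" using h k by (intro lip)
      also have "\<dots> \<le> j \<oplus> \<delta> h k" using tj by (intro pl_mono) auto
      finally show ?thesis .
    qed
    have sm: "s k k' \<le> (j \<oplus> \<delta> h k) \<oplus> (j \<oplus> \<delta> h k')" if "k \<in> V" "k' \<in> V" for k k'
    proof -
      have "s k k' \<le> (tgt h \<oplus> \<delta> h k) \<oplus> (tgt h \<oplus> \<delta> h k')" using that h tj jn by (intro sums) auto
      also have "\<dots> \<le> (j \<oplus> \<delta> h k) \<oplus> (j \<oplus> \<delta> h k')" using tj by (intro pl_mono) auto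
      finally show ?thesis .
    qed
    obtain G c' where G: "Y \<subseteq> G" "\<forall>v\<in>V. \<forall>y\<in>Y. c' v y = c v y"
      and cfg: "config \<Gamma> V \<delta> s G c' (lv(h := j))"
      using lower_step[OF less.prems(1) h(1) j \<delta>0[OF h(1)] \<delta>sym \<delta>tri lvl sm] by blast
    have "(\<Sum>v\<in>V. (lv(h := j)) v - tgt v) < (\<Sum>v\<in>V. lv v - tgt v)"
      using finV h j tj by (intro sum_strict_mono_ex1) auto
    moreover have "tgt v \<le> (lv(h := j)) v \<and> (lv(h := j)) v \<le> n" if "v \<in> V" for v
      using less.prems(2)[OF that] tj jn by auto
    ultimately obtain H c'' where H: "G \<subseteq> H" "\<forall>v\<in>V. \<forall>y\<in>G. c'' v y = c' v y"
      "config \<Gamma> V \<delta> s H c'' tgt"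
      using less.hyps[OF _ cfg] by blast
    then have "Y \<subseteq> H" "\<forall>v\<in>V. \<forall>y\<in>Y. c'' v y = c v y" using G by (auto simp: subset_iff)
    then show ?thesis using H(3) by blast
  qed
qed

section \<open>Distances and levels of types over a finite set\<close>

definition types :: "'a set \<Rightarrow> ('a \<Rightarrow> nat) set" where
  "types A = {f \<in> extensional A. katetov A f}"

text \<open>Inserting \<open>n\<close> keeps the minimum defined for empty \<open>A\<close> and
  gives the empty type the maximal level.\<close>

definition level :: "'a set \<Rightarrow> ('a \<Rightarrow> nat) \<Rightarrow> nat" where
  "level A f = Min (insert n (f ` A))"

text \<open>The minima in \<open>fdist\<close> and \<open>fsum\<close> are the smallest and the largest distance at which two points
  realising \<open>f\<close> and \<open>g\<close> can be placed.\<close>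

definition fdist :: "'a set \<Rightarrow> ('a \<Rightarrow> nat) \<Rightarrow> ('a \<Rightarrow> nat) \<Rightarrow> nat" where
  "fdist A f g = Min {e. e \<le> n \<and> (\<forall>a\<in>A. f a \<le> g a \<oplus> e \<and> g a \<le> f a \<oplus> e)}"

definition fsum :: "'a set \<Rightarrow> ('a \<Rightarrow> nat) \<Rightarrow> ('a \<Rightarrow> nat) \<Rightarrow> nat" where
  "fsum A f g = Min (insert n ((\<lambda>a. f a \<oplus> g a) ` A))"

text \<open>Weaker than \<open>katetov\<close> on purpose: the virtual point \<open>\<kappa>\<close>
  of \<open>good_step\<close> takes the value 0, so it is not a type, yet it needs the same distance
  lemmas.\<close>

definition bdd :: "'a set \<Rightarrow> ('a \<Rightarrow> nat) \<Rightarrow> bool" where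
  "bdd A f \<longleftrightarrow> (\<forall>a\<in>A. f a \<le> n)"

text \<open>The set in \<open>fdist\<close> contains \<open>n\<close>, so its minimum is
  attained.\<close>

lemma fdist_in:
  assumes "bdd A f" "bdd A g"
  shows "fdist A f g \<le> n" "a \<in> A \<Longrightarrow> f a \<le> g a \<oplus> fdist A f g" "a \<in> A \<Longrightarrow> g a \<le> f a \<oplus> fdist A f g"
proof -
  let ?S = "{e. e \<le> n \<and> (\<forall>a\<in>A. f a \<le> g a \<oplus> e \<and> g a \<le> f a \<oplus> e)}"
  have "f a \<le> g a \<oplus> n \<and> g a \<le> f a \<oplus> n" if "a \<in> A" for a
    using le_pl2[of n] assms that unfolding bdd_def by (meson order_refl order_trans)
  then have "n \<in> ?S" by auto
  moreover have "finite ?S" by simp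
  ultimately have "fdist A f g \<in> ?S" unfolding fdist_def by (intro Min_in) auto
  then show "fdist A f g \<le> n" "a \<in> A \<Longrightarrow> f a \<le> g a \<oplus> fdist A f g"
    "a \<in> A \<Longrightarrow> g a \<le> f a \<oplus> fdist A f g" by auto
qed

lemma fdist_least:
  "e \<le> n \<Longrightarrow> (\<And>a. a \<in> A \<Longrightarrow> f a \<le> g a \<oplus> e \<and> g a \<le> f a \<oplus> e) \<Longrightarrow> fdist A f g \<le> e"
  unfolding fdist_def by (intro Min_le) auto

lemma fdist_sym: "fdist A f g = fdist A g f"
  unfolding fdist_def by (metis (no_types, opaque_lifting))

lemma fdist_refl: "bdd A f \<Longrightarrow> fdist A f f = 0"
  using fdist_least[of 0 A f f] pl_0 unfolding bdd_def by auto

lemma fdist_tri: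
  assumes "bdd A f" "bdd A g" "bdd A h"
  shows "fdist A f h \<le> fdist A f g \<oplus> fdist A g h"
proof (rule fdist_least[OF pl_le])
  fix a assume a: "a \<in> A"
  have "f a \<le> (h a \<oplus> fdist A g h) \<oplus> fdist A f g"
    using fdist_in(2)[OF assms(1,2) a] pl_mono1[OF fdist_in(2)[OF assms(2,3) a]] order_trans by blast
  moreover have "h a \<le> (f a \<oplus> fdist A f g) \<oplus> fdist A g h"
    using fdist_in(3)[OF assms(2,3) a] pl_mono1[OF fdist_in(3)[OF assms(1,2) a]] order_trans by blast
  ultimately show "f a \<le> h a \<oplus> (fdist A f g \<oplus> fdist A g h) \<and> h a \<le> f a \<oplus> (fdist A f g \<oplus> fdist A g h)"
    by (simp add: pl_ac)
qed

text \<open>Distance 0 forces agreement on \<open>A\<close>; extensionality turns this into equality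
  of functions, so distinct virtual points are at positive distance.\<close>

lemma fdist_pos:
  assumes "bdd A f" "bdd A g" "f \<in> extensional A" "g \<in> extensional A" "f \<noteq> g"
  shows "0 < fdist A f g"
proof (rule ccontr)
  assume "\<not> 0 < fdist A f g"
  then have 0: "fdist A f g = 0" by simp
  have "f a = g a" if "a \<in> A" for a
    using fdist_in(2,3)[OF assms(1,2) that] pl_0 assms(1,2) that unfolding 0 bdd_def by auto
  then show False using assms(3-5) extensionalityI by blast
qed

lemma level_le: "finite A \<Longrightarrow> level A f \<le> n" "finite A \<Longrightarrow> a \<in> A \<Longrightarrow> level A f \<le> f a"
  unfolding level_def by auto

lemma level_attained: "finite A \<Longrightarrow> level A f < n \<Longrightarrow> \<exists>a\<in>A. f a = level A f"
  using Min_in[of "insert n (f ` A)"] unfolding level_def by auto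

lemma fsum_le: "finite A \<Longrightarrow> fsum A f g \<le> n" "finite A \<Longrightarrow> a \<in> A \<Longrightarrow> fsum A f g \<le> f a \<oplus> g a"
  unfolding fsum_def by auto

lemma fsum_ge:
  "finite A \<Longrightarrow> b \<le> n \<Longrightarrow> (\<And>a. a \<in> A \<Longrightarrow> b \<le> f a \<oplus> g a) \<Longrightarrow> b \<le> fsum A f g"
  unfolding fsum_def by auto

text \<open>Provides \<open>lip\<close> of \<open>lower_all\<close> for the targets
  \<open>level\<close>. The inequality is read off at a point where \<open>f\<close> attains its
  level; if that level is \<open>n\<close>, the bound is trivial.\<close>

lemma level_fdist:
  assumes "finite A" "bdd A f" "bdd A g"
  shows "level A g \<le> level A f \<oplus> fdist A f g"
proof (cases "level A f < n")
  case True
  then obtain a where a: "a \<in> A" "f a = level A f" using level_attained assms(1) by blast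
  have "level A g \<le> g a" using level_le assms(1) a by blast
  also have "\<dots> \<le> f a \<oplus> fdist A f g" by (rule fdist_in(3)[OF assms(2,3) a(1)])
  finally show ?thesis using a by simp
next
  case False
  then have "level A f = n" using level_le(1)[OF assms(1), of f] by simp
  then show ?thesis using level_le(1)[OF assms(1), of g] le_pl1[of n] order_trans by auto
qed

text \<open>Provides \<open>sums\<close> of \<open>lower_all\<close>. A level below \<open>n\<close>
  is attained at some \<open>a\<close> in \<open>A\<close>, and both summands are compared
  there.\<close>

lemma fsum_fdist:
  assumes "finite A" "bdd A u" "bdd A v" "bdd A w" "level A u < n"
  shows "fsum A v w \<le> (level A u \<oplus> fdist A u v) \<oplus> (level A u \<oplus> fdist A u w)"
proof -
  obtain a where a: "a \<in> A" "u a = level A u" using level_attained assms by blast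
  have "fsum A v w \<le> v a \<oplus> w a" using fsum_le assms(1) a by blast
  also have "\<dots> \<le> (u a \<oplus> fdist A u v) \<oplus> (u a \<oplus> fdist A u w)"
    using assms a by (intro pl_mono fdist_in(3))
  finally show ?thesis using a by simp
qed

section \<open>Point-by-point construction of the copy\<close>

definition good :: "'a set \<Rightarrow> 'a set \<Rightarrow> bool" where
  "good \<Gamma> A \<longleftrightarrow> finite A \<and> A \<subseteq> \<Gamma> \<and> (\<exists>Y \<Phi>. A \<subseteq> Y \<and> (\<forall>f\<in>types A. \<forall>a\<in>A. \<Phi> f a = f a) \<and>
     config \<Gamma> (types A) (fdist A) (fsum A) Y \<Phi> (level A))"

text \<open>There is exactly one type over the empty set, and its level is \<open>n\<close>. A type
  of level \<open>n\<close> is constantly \<open>n\<close> on \<open>F\<close>, so the coherence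
  conditions hold trivially at the top rank.\<close>

lemma good_empty:
  assumes "type_ge n F f" "large \<Gamma> n F f"
  shows "good \<Gamma> {}"
proof -
  have f: "f y = n" if "y \<in> F" for y
    using assms that unfolding type_ge_def katetov_def by force
  have 0: "n \<le> f y \<oplus> f y" "f y \<le> f y \<oplus> i" if "y \<in> F" for y i
    using f[OF that] le_pl1[of n] by auto
  have "config \<Gamma> (types {}) (fdist {}) (fsum {}) F (\<lambda>_. f) (level {})"
    using assms 0 unfolding config_def type_ge_def fsum_def level_def by auto
  then show ?thesis unfolding good_def by auto
qed

text \<open>The virtual points are the types over \<open>A\<close> with a placeholder
  \<open>x0\<close> added, and the placeholder itself. Once their levels are lowered, the
  placeholder is large at level 0, so some \<open>x\<close> in \<Gamma> realises it. As
  \<open>x\<close> and \<open>x0\<close> have the same distances to \<open>A\<close>, the extended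
  types then serve over \<open>insert x A\<close>.\<close>

lemma good_step:
  assumes "good \<Gamma> A" and \<Gamma>M: "\<Gamma> \<subseteq> M" and g: "g \<in> types A"
  shows "\<exists>x\<in>\<Gamma>. x \<notin> A \<and> (\<forall>a\<in>A. d x a = g a) \<and> good \<Gamma> (insert x A)"
proof -
  obtain Y \<Phi> where finA: "finite A" and A\<Gamma>: "A \<subseteq> \<Gamma>" and AY: "A \<subseteq> Y"
    and \<Phi>: "\<And>f a. f \<in> types A \<Longrightarrow> a \<in> A \<Longrightarrow> \<Phi> f a = f a"
    and cfg: "config \<Gamma> (types A) (fdist A) (fsum A) Y \<Phi> (level A)"
    using assms(1) unfolding good_def by blast
  have AM: "A \<subseteq> M" using A\<Gamma> \<Gamma>M by auto
  have "type_ge 0 A g" using g finA AM unfolding type_ge_def types_def by auto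
  then obtain x0 where x0: "x0 \<in> M" "\<And>a. a \<in> A \<Longrightarrow> d x0 a = g a" using type_realized by blast
  have g1: "1 \<le> g a \<and> g a \<le> n" if "a \<in> A" for a using g that unfolding types_def katetov_def by auto
  have x0A: "x0 \<notin> A" using x0 g1 d_0[of x0 x0] by fastforce
  define B where "B = insert x0 A"
  have finB: "finite B" and BM: "B \<subseteq> M" and AB: "A \<subseteq> B" using finA AM x0 by (auto simp: B_def)
  \<comment> \<open>\<open>x0\<close> is a placeholder, of any colour, for the point to be found. As the function \<open>\<kappa>\<close>
    it becomes a virtual point of target level \<open>0\<close>; its distance to a type \<open>f\<close> is \<open>f x0\<close>.\<close>
  define \<kappa> where "\<kappa> = restrict (d x0) B"
  have \<kappa>0: "\<kappa> x0 = 0" using d_0[of x0 x0] x0 by (simp add: \<kappa>_def B_def)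
  have \<kappa>a: "\<kappa> a = g a" "\<kappa> a = d x0 a" if "a \<in> A" for a using x0 that by (auto simp: \<kappa>_def B_def)
  define V where "V = insert \<kappa> (types B)"
  have bT: "bdd C f" if "f \<in> types C" for C f
    using that unfolding types_def katetov_def bdd_def by auto
  have bV: "bdd B v" if "v \<in> V" for v
    using that bT x0 BM d_le by (auto simp: V_def bdd_def \<kappa>_def)
  have eV: "v \<in> extensional B" if "v \<in> V" for v
    using that by (auto simp: V_def types_def \<kappa>_def)
  have finV: "finite V"
  proof (rule finite_subset)
    show "V \<subseteq> PiE B (\<lambda>_. {..n})" using bV eV by (auto simp: bdd_def PiE_def)
    show "finite (PiE B (\<lambda>_. {..n}))" using finB by (intro finite_PiE) auto
  qed
  have rV: "restrict v A \<in> types A" if "v \<in> V" for v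
  proof (cases "v = \<kappa>")
    case True
    then have "restrict v A = g" using g \<kappa>a(1) by (auto simp: types_def extensional_def restrict_def)
    then show ?thesis using g by simp
  next
    case False
    then have "katetov B v" using that by (auto simp: V_def types_def)
    then show ?thesis using AB by (auto simp: types_def katetov_def subset_iff)
  qed
  have rlv: "level A (restrict v A) = level A v" for v unfolding level_def by simp
  have rfd: "fdist A (restrict v A) (restrict w A) \<le> fdist B v w" if "v \<in> V" "w \<in> V" for v w
    by (rule fdist_least) (use fdist_in[OF bV[OF that(1)] bV[OF that(2)]] AB in auto)
  have rfs: "fsum B v w \<le> fsum A (restrict v A) (restrict w A)" if "v \<in> V" "w \<in> V" for v w
    using fsum_le[OF finB] AB finA by (intro fsum_ge) auto
  \<comment> \<open>The configuration over \<open>A\<close> is pulled back along restriction.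
    Restricting from \<open>B\<close> to \<open>A\<close> can only decrease \<open>fdist\<close> and
    increase \<open>fsum\<close>, so coherence survives; the levels start at \<open>level A\<close>
    and have to come down to \<open>level B\<close>.\<close>
  have cfg0: "config \<Gamma> V (fdist B) (fsum B) Y (\<lambda>v. \<Phi> (restrict v A)) (level A)"
  proof -
    have "\<Phi> (restrict v A) y \<le> \<Phi> (restrict w A) y \<oplus> fdist B v w \<and>
        fsum B v w \<le> \<Phi> (restrict v A) y \<oplus> \<Phi> (restrict w A) y"
      if "v \<in> V" "w \<in> V" "y \<in> Y" for v w y
    proof -
      have "\<Phi> (restrict v A) y \<le> \<Phi> (restrict w A) y \<oplus> fdist A (restrict v A) (restrict w A)"
        "fsum A (restrict v A) (restrict w A) \<le> \<Phi> (restrict v A) y \<oplus> \<Phi> (restrict w A) y"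
        using cfg rV that unfolding config_def by blast+
      then show ?thesis using rfd[OF that(1,2)] rfs[OF that(1,2)] pl_mono order_refl order_trans by meson
    qed
    moreover have "type_ge (level A v) Y (\<Phi> (restrict v A)) \<and> large \<Gamma> (level A v) Y (\<Phi> (restrict v A))"
      if "v \<in> V" for v
      using cfg rV[OF that] rlv[of v] unfolding config_def by metis
    ultimately show ?thesis using cfg unfolding config_def by blast
  qed
  have lvAB: "level B v \<le> level A v \<and> level A v \<le> n" for v
    using finA finB AB unfolding level_def by (intro conjI Min_antimono) auto
  have "\<exists>G c. Y \<subseteq> G \<and> (\<forall>v\<in>V. \<forall>y\<in>Y. c v y = \<Phi> (restrict v A) y) \<and>
      config \<Gamma> V (fdist B) (fsum B) G c (level B)"
  proof (rule lower_all[OF finV cfg0])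
    show "level B v \<le> level A v \<and> level A v \<le> n" for v by (rule lvAB)
    show "fdist B v v = 0" if "v \<in> V" for v by (rule fdist_refl[OF bV[OF that]])
    show "0 < fdist B v w" if "v \<in> V" "w \<in> V" "v \<noteq> w" for v w
      using that by (intro fdist_pos bV eV)
    show "fdist B v w = fdist B w v" for v w by (rule fdist_sym)
    show "fdist B u w \<le> fdist B u v \<oplus> fdist B v w" if "u \<in> V" "v \<in> V" "w \<in> V" for u v w
      using that by (intro fdist_tri bV)
    show "level B w \<le> level B v \<oplus> fdist B v w" if "v \<in> V" "w \<in> V" for v w
      using that by (intro level_fdist bV finB)
    show "fsum B v w \<le> (level B u \<oplus> fdist B u v) \<oplus> (level B u \<oplus> fdist B u w)"
      if "u \<in> V" "v \<in> V" "w \<in> V" "level B u < n" for u v w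
      using that by (intro fsum_fdist bV finB)
  qed
  then obtain G c where YG: "Y \<subseteq> G" and cY: "\<And>v y. v \<in> V \<Longrightarrow> y \<in> Y \<Longrightarrow> c v y = \<Phi> (restrict v A) y"
    and cfgG: "config \<Gamma> V (fdist B) (fsum B) G c (level B)"
    by blast
  have finG: "finite G" and GM: "G \<subseteq> M"
    and tG: "\<And>v. v \<in> V \<Longrightarrow> type_ge (level B v) G (c v)"
    and lG: "\<And>v. v \<in> V \<Longrightarrow> large \<Gamma> (level B v) G (c v)"
    and c\<delta>: "\<And>v w y. v \<in> V \<Longrightarrow> w \<in> V \<Longrightarrow> y \<in> G \<Longrightarrow> c v y \<le> c w y \<oplus> fdist B v w"
    and cs: "\<And>v w y. v \<in> V \<Longrightarrow> w \<in> V \<Longrightarrow> y \<in> G \<Longrightarrow> fsum B v w \<le> c v y \<oplus> c w y"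
    using cfgG unfolding config_def by blast+
  have \<kappa>V: "\<kappa> \<in> V" by (simp add: V_def)
  have cA: "c v a = v a" if "v \<in> V" "a \<in> A" for v a
    using cY[of v a] \<Phi>[OF rV] that AY by auto
  \<comment> \<open>The value 0 at \<open>x0\<close> forces level 0, and largeness at level 0 is
    realisation by a point of \<Gamma>.\<close>
  have "level B \<kappa> = 0" using level_le(2)[OF finB, of x0 \<kappa>] \<kappa>0 by (simp add: B_def)
  then have "large \<Gamma> 0 G (c \<kappa>)" "extends 0 G (c \<kappa>) G (c \<kappa>)"
    using lG[OF \<kappa>V] tG[OF \<kappa>V] extends_refl by auto
  then have "\<exists>x\<in>\<Gamma>. \<forall>y\<in>G. d x y = c \<kappa> y"
    unfolding large.simps by blast
  then obtain x where x: "x \<in> \<Gamma>" "\<And>y. y \<in> G \<Longrightarrow> d x y = c \<kappa> y" by blast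
  have xM: "x \<in> M" using x \<Gamma>M by auto
  have "1 \<le> d x y" if "y \<in> G" for y
    using x tG[OF \<kappa>V] that unfolding type_ge_def katetov_def by auto
  then have xG: "x \<notin> G" using d_0[of x x] xM by fastforce
  have xA: "x \<notin> A" using xG AY YG by auto
  have dx: "d x a = g a" if "a \<in> A" for a
    using x(2)[of a] cA[OF \<kappa>V that] \<kappa>a(1)[OF that] that AY YG by auto
  define A' where "A' = insert x A"
  have finA': "finite A'" using finA by (simp add: A'_def)
  have A'M: "A' \<subseteq> M" using AM xM by (auto simp: A'_def)
  \<comment> \<open>Renaming \<open>x\<close> to \<open>x0\<close> carries types over
    \<open>A'\<close> to types over \<open>B\<close>; \<open>ball\<close> and \<open>img\<close>
    show that levels, \<open>fdist\<close> and \<open>fsum\<close> are unaffected.\<close>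
  define tr where "tr f = (\<lambda>b\<in>B. if b = x0 then f x else f b)" for f :: "'a \<Rightarrow> nat"
  have tr0: "tr f x0 = f x" and trA: "a \<in> A \<Longrightarrow> tr f a = f a" for f a
    using x0A by (auto simp: tr_def B_def)
  have ball: "(\<forall>b\<in>B. Q (tr f b) (tr f' b)) \<longleftrightarrow> (\<forall>a\<in>A'. Q (f a) (f' a))" for Q f f'
    using tr0 trA unfolding B_def A'_def by auto
  have img: "(\<lambda>b. Q (tr f b) (tr f' b)) ` B = (\<lambda>a. Q (f a) (f' a)) ` A'" for Q :: "nat \<Rightarrow> nat \<Rightarrow> nat" and f f'
    using tr0 trA unfolding B_def A'_def by auto
  have lvtr: "level B (tr f) = level A' f" for f
    using img[of "\<lambda>i j. i" f f] unfolding level_def by simp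
  have fdtr: "fdist B (tr f) (tr f') = fdist A' f f'" for f f'
    using ball[of "\<lambda>i j. i \<le> j \<oplus> e \<and> j \<le> i \<oplus> e" f f' for e] unfolding fdist_def by simp
  have fstr: "fsum B (tr f) (tr f') = fsum A' f f'" for f f'
    using img[of "(\<oplus>)" f f'] unfolding fsum_def by simp
  have kA': "f a \<le> f b \<oplus> d a b" "d a b \<le> f a \<oplus> f b" "1 \<le> f a" "f a \<le> n"
    if "f \<in> types A'" "a \<in> A'" "b \<in> A'" for f a b
    using that unfolding types_def katetov_def by auto
  \<comment> \<open>The renaming \<open>p\<close> from \<open>B\<close> to \<open>A'\<close>
    preserves distances, so the inequalities of \<open>f\<close> pull back.\<close>
  have trV: "tr f \<in> V" if f: "f \<in> types A'" for f
  proof -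
    define p where "p b = (if b = x0 then x else b)" for b
    have p: "p b \<in> A'" "tr f b = f (p b)" if "b \<in> B" for b
      using that by (auto simp: p_def A'_def B_def tr_def)
    have dp: "d (p a) (p b) = d a b" if "a \<in> B" "b \<in> B" for a b
    proof -
      have swap: "d c x = d c x0" if "c \<in> A" for c
        using d_sym[of c x] d_sym[of c x0] dx x0 that AM xM by (simp add: subset_iff)
      have "d x x = 0" "d x0 x0 = 0" using d_0 xM x0(1) by blast+
      then show ?thesis using that dx x0(2) x0A swap unfolding p_def B_def by auto
    qed
    have "katetov B (tr f)"
      unfolding katetov_def
    proof (intro conjI ballI)
      fix a b assume ab: "a \<in> B" "b \<in> B"
      show "1 \<le> tr f a" "tr f a \<le> n" using kA'(3,4)[OF f p(1) p(1)] p(2) ab by simp_all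
      show "tr f a \<le> tr f b \<oplus> d a b" "d a b \<le> tr f a \<oplus> tr f b"
        using kA'(1,2)[OF f p(1)[OF ab(1)] p(1)[OF ab(2)]] p(2)[OF ab(1)] p(2)[OF ab(2)] dp[OF ab]
        by simp_all
    qed
    then show ?thesis by (auto simp: V_def types_def tr_def)
  qed
  \<comment> \<open>The prescribed value \<open>f x\<close> lies between the least and the largest
    admissible distance of \<open>\<kappa>\<close> and \<open>tr f\<close>. At \<open>x0\<close>
    this holds because \<open>\<kappa>\<close> vanishes there, elsewhere by the inequalities of
    \<open>f\<close> at \<open>x\<close>.\<close>
  have fs\<kappa>: "f x \<le> fsum B \<kappa> (tr f)" and fd\<kappa>: "fdist B \<kappa> (tr f) \<le> f x" if f: "f \<in> types A'" for f
  proof -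
    have xA': "x \<in> A'" by (simp add: A'_def)
    have fx: "f x \<le> n" using kA'(4)[OF f xA' xA'] .
    have *: "f x \<le> \<kappa> b \<oplus> tr f b \<and> \<kappa> b \<le> tr f b \<oplus> f x \<and> tr f b \<le> \<kappa> b \<oplus> f x" if "b \<in> B" for b
    proof (cases "b = x0")
      case True
      then show ?thesis using \<kappa>0 tr0 le_pl2[OF fx] by auto
    next
      case False
      then have b: "b \<in> A" "b \<in> A'" using that by (auto simp: A'_def B_def)
      have 1: "\<kappa> b = d x b" using \<kappa>a(1) dx b by simp
      have 2: "d b x = d x b" using d_sym b A'M xM by auto
      show ?thesis unfolding 1 trA[OF b(1)]
        using kA'[OF f xA' b(2)] kA'(1)[OF f b(2) xA'] unfolding 2 by (simp add: pl_comm)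
    qed
    show "f x \<le> fsum B \<kappa> (tr f)" using * fx finB by (intro fsum_ge) auto
    show "fdist B \<kappa> (tr f) \<le> f x" using * fx by (intro fdist_least) auto
  qed
  define \<Phi>' where "\<Phi>' f = (c (tr f))(x := f x)" for f
  have \<Phi>'x: "\<Phi>' f x = f x" and \<Phi>'G: "y \<in> G \<Longrightarrow> \<Phi>' f y = c (tr f) y" for f y
    using xG by (auto simp: \<Phi>'_def)
  have T: "type_ge (level A' f) (insert x G) (\<Phi>' f)" if f: "f \<in> types A'" for f
  proof -
    have xA': "x \<in> A'" by (simp add: A'_def)
    have tf: "type_ge (level A' f) G (c (tr f))" using tG[OF trV[OF f]] lvtr by simp
    \<comment> \<open>Triangles with vertex \<open>x\<close>: since \<open>d x y\<close> equals
      \<open>c \<kappa> y\<close>, they follow from coherence of \<open>\<kappa>\<close> with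
      \<open>tr f\<close>, the lower bound \<open>fsum\<close> giving the first and the upper bound
      \<open>fdist\<close> the other two.\<close>
    have 1: "f x \<le> c (tr f) y \<oplus> d x y" "c (tr f) y \<le> f x \<oplus> d x y" "d x y \<le> f x \<oplus> c (tr f) y"
      if y: "y \<in> G" for y
    proof -
      show "f x \<le> c (tr f) y \<oplus> d x y"
        using fs\<kappa>[OF f] cs[OF \<kappa>V trV[OF f] y] x(2)[OF y] by (simp add: pl_comm)
      have "c (tr f) y \<le> c \<kappa> y \<oplus> fdist B (tr f) \<kappa>" using c\<delta> \<kappa>V trV[OF f] y by blast
      also have "\<dots> \<le> c \<kappa> y \<oplus> f x" using fd\<kappa>[OF f] by (simp add: fdist_sym pl_mono)
      finally show "c (tr f) y \<le> f x \<oplus> d x y" using x(2)[OF y] by (simp add: pl_comm)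
      have "c \<kappa> y \<le> c (tr f) y \<oplus> fdist B \<kappa> (tr f)" using c\<delta> \<kappa>V trV[OF f] y by blast
      also have "\<dots> \<le> c (tr f) y \<oplus> f x" using fd\<kappa>[OF f] by (simp add: pl_mono)
      finally show "d x y \<le> f x \<oplus> c (tr f) y" using x(2)[OF y] by (simp add: pl_comm)
    qed
    have dyx: "d y x = d x y" if "y \<in> G" for y using d_sym GM xM that by auto
    have dxx: "d x x = 0" using d_0 xM by auto
    have fx: "1 \<le> f x" "f x \<le> n" "level A' f \<le> f x"
      using kA'[OF f xA' xA'] level_le(2)[OF finA' xA'] by auto
    have "katetov (insert x G) (\<Phi>' f)"
      unfolding katetov_def
    proof (intro conjI ballI)
      fix y z assume yz: "y \<in> insert x G" "z \<in> insert x G"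
      show "1 \<le> \<Phi>' f y" "\<Phi>' f y \<le> n"
        using yz tf fx \<Phi>'x \<Phi>'G unfolding type_ge_def katetov_def by auto
      consider "y = x" "z = x" | "y = x" "z \<in> G" | "y \<in> G" "z = x" | "y \<in> G" "z \<in> G" using yz by auto
      then have "\<Phi>' f y \<le> \<Phi>' f z \<oplus> d y z \<and> d y z \<le> \<Phi>' f y \<oplus> \<Phi>' f z"
      proof cases
        case 1
        then show ?thesis
          using \<Phi>'x[of f] dxx pl_0 fx by auto
      next
        case 2
        then show ?thesis
          using \<Phi>'x[of f] \<Phi>'G[of z f] 1[of z] by simp_all
      next
        case 3
        then show ?thesis
          using \<Phi>'x[of f] \<Phi>'G[of y f] 1[of y] dyx[of y] pl_comm[of "f x" "c (tr f) y"] by simp_all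
      next
        case 4
        then show ?thesis
          using \<Phi>'G[of y f] \<Phi>'G[of z f] tf unfolding type_ge_def katetov_def by simp_all
      qed
      then show "\<Phi>' f y \<le> \<Phi>' f z \<oplus> d y z" "d y z \<le> \<Phi>' f y \<oplus> \<Phi>' f z"
        by auto
    qed
    then show ?thesis unfolding type_ge_def
      using tf \<Phi>'x \<Phi>'G fx finG GM xM by (auto simp: type_ge_def)
  qed
  have L: "large \<Gamma> (level A' f) (insert x G) (\<Phi>' f)" if f: "f \<in> types A'" for f
  proof -
    have "extends (level A' f) G (c (tr f)) (insert x G) (\<Phi>' f)"
      unfolding extends_def using T[OF f] \<Phi>'G by auto
    then show ?thesis using lG[OF trV[OF f]] lvtr large_extends by simp
  qed
  have D: "\<Phi>' f y \<le> \<Phi>' f' y \<oplus> fdist A' f f' \<and> fsum A' f f' \<le> \<Phi>' f y \<oplus> \<Phi>' f' y"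
    if f: "f \<in> types A'" "f' \<in> types A'" and y: "y \<in> insert x G" for f f' y
  proof (cases "y = x")
    case True
    have "x \<in> A'" by (simp add: A'_def)
    then show ?thesis
      using True \<Phi>'x fdist_in(2)[OF bT[OF f(1)] bT[OF f(2)]] fsum_le(2)[OF finA'] by auto
  next
    case False
    then have y: "y \<in> G" using y by auto
    show ?thesis using c\<delta>[OF trV[OF f(1)] trV[OF f(2)] y] cs[OF trV[OF f(1)] trV[OF f(2)] y]
      fdtr fstr \<Phi>'G[OF y] by simp
  qed
  have "config \<Gamma> (types A') (fdist A') (fsum A') (insert x G) \<Phi>' (level A')"
    unfolding config_def using finG GM xM T L D by blast
  moreover have "A' \<subseteq> insert x G" using AY YG by (auto simp: A'_def)
  moreover have "\<Phi>' f a = f a" if "f \<in> types A'" "a \<in> A'" for f a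
  proof (cases "a = x")
    case False
    then have "a \<in> A" using that by (auto simp: A'_def)
    then show ?thesis using \<Phi>'G[of a f] cA[OF trV[OF that(1)]] trA AY YG by auto
  qed (simp add: \<Phi>'x)
  moreover have "A' \<subseteq> \<Gamma>" using A\<Gamma> x by (auto simp: A'_def)
  ultimately have "good \<Gamma> A'" unfolding good_def using finA' by blast
  then show ?thesis using x(1) xA dx A'_def by blast
qed

text \<open>\<open>M\<close> is enumerated and the embedding grows along initial segments
  \<open>S k\<close>, each new image coming from \<open>good_step\<close>. The partial maps are
  total functions whose values matter on \<open>S k\<close> only.\<close>

lemma good_embedding:
  assumes good: "good \<Gamma> {}" and \<Gamma>M: "\<Gamma> \<subseteq> M" and M: "countable M" "M \<noteq> {}"
  shows "\<exists>f. f ` M \<subseteq> \<Gamma> \<and> (\<forall>x\<in>M. \<forall>y\<in>M. d (f x) (f y) = d x y)"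
proof -
  define e where "e = from_nat_into M"
  have eM: "e k \<in> M" for k using from_nat_into M by (simp add: e_def)
  define S where "S k = e ` {..<k}" for k
  have S_Suc: "S (Suc k) = insert (e k) (S k)" for k by (auto simp: S_def lessThan_Suc)
  have SM: "S k \<subseteq> M" for k using eM by (auto simp: S_def)
  define P where "P k \<phi> \<longleftrightarrow> good \<Gamma> (\<phi> ` S k) \<and> (\<forall>x\<in>S k. \<forall>y\<in>S k. d (\<phi> x) (\<phi> y) = d x y)" for k \<phi>
  define Q where "Q k \<phi> \<phi>' \<longleftrightarrow> (\<forall>x\<in>S k. \<phi>' x = \<phi> x)" for k and \<phi> \<phi>' :: "'a \<Rightarrow> 'a"
  have step: "\<exists>\<phi>'. P (Suc k) \<phi>' \<and> Q k \<phi> \<phi>'" if P: "P k \<phi>" for k \<phi>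
  \<comment> \<open>For finite \<open>M\<close> the enumeration repeats points, and then nothing has
    to be added.\<close>
  proof (cases "e k \<in> S k")
    case True
    then have "S (Suc k) = S k" using S_Suc by auto
    then show ?thesis using P unfolding P_def Q_def by auto
  next
    case False
    let ?A = "\<phi> ` S k"
    have iso: "d (\<phi> x) (\<phi> y) = d x y" if "x \<in> S k" "y \<in> S k" for x y using P that by (simp add: P_def)
    have AM: "?A \<subseteq> M" using P \<Gamma>M by (auto simp: P_def good_def)
    have "inj_on \<phi> (S k)"
    proof (rule inj_onI)
      fix x y assume xy: "x \<in> S k" "y \<in> S k" "\<phi> x = \<phi> y"
      then have "d x y = 0" using iso[of x y] d_0[of "\<phi> y" "\<phi> y"] AM by auto
      then show "x = y" using d_0[of x y] SM xy by blast
    qed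
    then have inv: "inv_into (S k) \<phi> (\<phi> x) = x" if "x \<in> S k" for x using that by simp
    \<comment> \<open>The type of the next point \<open>e k\<close> over \<open>S k\<close>,
      transported to the image along the partial isometry.\<close>
    define g where "g = (\<lambda>b\<in>?A. d (e k) (inv_into (S k) \<phi> b))"
    have g: "g (\<phi> x) = d (e k) x" if "x \<in> S k" for x using that inv by (simp add: g_def)
    have "katetov ?A g"
      unfolding katetov_def
    proof (intro conjI ballI)
      fix a b assume "a \<in> ?A" "b \<in> ?A"
      then obtain x y where x: "x \<in> S k" "a = \<phi> x" and y: "y \<in> S k" "b = \<phi> y" by auto
      have xM: "x \<in> M" and yM: "y \<in> M" using x y SM by auto
      have "d (e k) x \<noteq> 0" using d_0[OF eM[of k] xM] False x by auto
      then show "1 \<le> g a" using g x by simp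
      show "g a \<le> n" using g x d_le[OF eM xM] by simp
      show "g a \<le> g b \<oplus> d a b"
        using d_tri[OF eM[of k] yM xM] g x y iso[OF x(1) y(1)] d_sym[OF xM yM] by simp
      show "d a b \<le> g a \<oplus> g b"
        using d_tri[OF xM eM[of k] yM] g x y iso[OF x(1) y(1)] d_sym[OF eM[of k] xM] by simp
    qed
    then have "g \<in> types ?A" by (auto simp: types_def g_def)
    then obtain z where z: "z \<in> \<Gamma>" "\<And>a. a \<in> ?A \<Longrightarrow> d z a = g a" "good \<Gamma> (insert z ?A)"
      using good_step[OF _ \<Gamma>M] P unfolding P_def by meson
    have zM: "z \<in> M" using z \<Gamma>M by auto
    have zx: "d z (\<phi> x) = d (e k) x" "d (\<phi> x) z = d x (e k)" if "x \<in> S k" for x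
    proof -
      show "d z (\<phi> x) = d (e k) x" using z(2) g that by simp
      moreover have "d z (\<phi> x) = d (\<phi> x) z" using that AM zM by (intro d_sym) auto
      moreover have "d (e k) x = d x (e k)" using that SM eM by (intro d_sym) auto
      ultimately show "d (\<phi> x) z = d x (e k)" by simp
    qed
    have zz: "d z z = 0" "d (e k) (e k) = 0" using d_0 zM eM by blast+
    have ne: "x \<noteq> e k" if "x \<in> S k" for x using that False by auto
    have "(\<phi>(e k := z)) ` S (Suc k) = insert z ?A" using ne unfolding S_Suc by auto
    moreover have "d ((\<phi>(e k := z)) x) ((\<phi>(e k := z)) y) = d x y"
      if xy: "x \<in> S (Suc k)" "y \<in> S (Suc k)" for x y
    proof -
      consider "x = e k" "y = e k" | "x = e k" "y \<in> S k" | "x \<in> S k" "y = e k" | "x \<in> S k" "y \<in> S k"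
        using xy unfolding S_Suc by blast
      then show ?thesis
      proof cases
        case 1 then show ?thesis using zz by simp
      next
        case 2 then show ?thesis using zx(1)[OF 2(2)] ne[OF 2(2)] by simp
      next
        case 3 then show ?thesis using zx(2)[OF 3(1)] ne[OF 3(1)] by simp
      next
        case 4 then show ?thesis using iso[OF 4] ne[OF 4(1)] ne[OF 4(2)] by simp
      qed
    qed
    ultimately have "P (Suc k) (\<phi>(e k := z))"
      unfolding P_def using z(3) by simp
    moreover have "Q k \<phi> (\<phi>(e k := z))" using ne by (auto simp: Q_def)
    ultimately show ?thesis by blast
  qed
  have "P 0 id" using good by (simp add: P_def S_def)
  then obtain \<phi> where \<phi>: "\<And>k. P k (\<phi> k)" "\<And>k. Q k (\<phi> k) (\<phi> (Suc k))"
    using dependent_nat_choice[of P Q] step by metis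
  have agree: "\<phi> k x = \<phi> l x" if "x \<in> S l" "l \<le> k" for k l x
    using that(2)
  proof (induction k rule: dec_induct)
    case (step m)
    have "S l \<subseteq> S m" using step(1) by (auto simp: S_def)
    then show ?case using step \<phi>(2)[of m] that(1) unfolding Q_def by auto
  qed simp
  \<comment> \<open>The successor is needed because \<open>S k\<close> holds only the points of
    index below \<open>k\<close>.\<close>
  define N where "N x = Suc (to_nat_on M x)" for x
  have xN: "x \<in> S k" if "x \<in> M" "N x \<le> k" for x k
    using that from_nat_into_to_nat_on[OF M(1) that(1)] unfolding S_def N_def e_def
    by (metis Suc_le_eq imageI lessThan_iff)
  define f where "f x = \<phi> (N x) x" for x
  have f: "f x = \<phi> k x" if "x \<in> M" "N x \<le> k" for x k
    using agree[of x "N x" k] xN[of x "N x"] that by (simp add: f_def)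
  have "d (f x) (f y) = d x y" if "x \<in> M" "y \<in> M" for x y
  proof -
    let ?k = "max (N x) (N y)"
    have "f x = \<phi> ?k x" "f y = \<phi> ?k y" "x \<in> S ?k" "y \<in> S ?k" using f xN that by auto
    then show ?thesis using \<phi>(1)[of ?k] unfolding P_def by auto
  qed
  moreover have "f x \<in> \<Gamma>" if "x \<in> M" for x
    using \<phi>(1)[of "N x"] xN[of x "N x"] that unfolding f_def P_def good_def by auto
  ultimately show ?thesis by blast
qed

text \<open>Either \<Gamma> is large at the empty type of level \<open>n\<close>, or its complement
  is large at some type of level \<open>n\<close>. Both cases start the construction through
  \<open>good_empty\<close>.\<close>

theorem embedding_dichotomy:
  assumes "\<Gamma> \<subseteq> M" "countable M" "M \<noteq> {}"
  shows "\<exists>f. (f ` M \<subseteq> \<Gamma> \<or> f ` M \<subseteq> M - \<Gamma>) \<and> (\<forall>x\<in>M. \<forall>y\<in>M. d (f x) (f y) = d x y)"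
proof -
  have t: "type_ge n {} f" for f unfolding type_ge_def katetov_def by simp
  have "good \<Gamma> {} \<or> good (M - \<Gamma>) {}"
  proof (cases "large \<Gamma> n {} (\<lambda>_. 0)")
    case True
    then show ?thesis using good_empty[OF t] by blast
  next
    case False
    then obtain G g where "type_ge n G g" "large (M - \<Gamma>) n G g"
      using large_dichotomy[OF t] unfolding extends_def by blast
    then show ?thesis using good_empty by blast
  qed
  then show ?thesis using good_embedding assms by (metis Diff_subset)
qed

end

section \<open>Extension and amalgamation in spaces of the class U_D\<close>

lemma metric_onD:
  assumes "metric_on M d" "x \<in> M" "y \<in> M"
  shows "0 \<le> d x y" "d x y = 0 \<longleftrightarrow> x = y" "d x y = d y x" "z \<in> M \<Longrightarrow> d x z \<le> d x y + d y z"
proof -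
  note m = assms(1)[unfolded metric_on_def]
  note p = m[THEN conjunct1, THEN bspec, OF assms(2), THEN bspec, OF assms(3)]
  show "0 \<le> d x y" by (rule p[THEN conjunct1])
  show "d x y = 0 \<longleftrightarrow> x = y" by (rule p[THEN conjunct2, THEN conjunct1])
  show "d x y = d y x" by (rule p[THEN conjunct2, THEN conjunct2])
  show "d x z \<le> d x y + d y z" if "z \<in> M"
    by (rule m[THEN conjunct2, THEN bspec, OF assms(2), THEN bspec, OF assms(3), THEN bspec, OF that])
qed

text \<open>Universality embeds \<open>F\<close> somewhere by \<open>p\<close>; homogeneity then
  moves the image of \<open>F0\<close> onto its prescribed place, along \<open>k\<close>.\<close>

lemma in_U_extend_embedding:
  fixes F :: "nat set"
  assumes U: "in_U D M d" and F: "finite F" "metric_on F e" "dist_set F e \<subseteq> D"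
    and F0: "F0 \<subseteq> F" "isom_emb F0 e M d q"
  shows "\<exists>p. isom_emb F e M d p \<and> (\<forall>x\<in>F0. p x = q x)"
proof -
  obtain p where p: "isom_emb F e M d p" using U F unfolding in_U_def by blast
  have met: "metric_on M d" using U unfolding in_U_def by blast
  have pM: "p x \<in> M" if "x \<in> F" for x using p that by (auto simp: isom_emb_def)
  have pe: "d (p x) (p y) = e x y" if "x \<in> F" "y \<in> F" for x y using p that by (auto simp: isom_emb_def)
  have inj: "inj_on p F"
  proof (rule inj_onI)
    fix x y assume xy: "x \<in> F" "y \<in> F" "p x = p y"
    then have "e x y = 0" using pe[OF xy(1,2)] metric_onD(2)[OF met pM pM, of x y] by simp
    then show "x = y" using metric_onD(2)[OF F(2) xy(1,2)] by simp
  qed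
  define k where "k = q \<circ> inv_into F p"
  have kp: "k (p x) = q x" if "x \<in> F" for x using inj that by (simp add: k_def)
  have qM: "q x \<in> M" if "x \<in> F0" for x using F0(2) that by (auto simp: isom_emb_def)
  have qe: "d (q x) (q y) = e x y" if "x \<in> F0" "y \<in> F0" for x y
    using F0(2) that by (auto simp: isom_emb_def)
  have sub: "finite (p ` F0)" "p ` F0 \<subseteq> M" "k ` p ` F0 \<subseteq> M"
    using finite_subset[OF F0(1) F(1)] F0(1) pM kp qM by auto
  have "isom_emb (p ` F0) d M d k"
    unfolding isom_emb_def
  proof (intro conjI ballI sub)
    fix a b assume "a \<in> p ` F0" "b \<in> p ` F0"
    then obtain x y where xy: "a = p x" "x \<in> F0" "b = p y" "y \<in> F0" by blast
    then have "x \<in> F" "y \<in> F" using F0(1) by auto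
    then show "d (k a) (k b) = d a b" unfolding xy(1,3) using qe[OF xy(2,4)] by (simp add: kp pe)
  qed
  then have "\<exists>g. isom_emb M d M d g \<and> g ` M = M \<and> (\<forall>x\<in>p ` F0. g x = k x)"
    using U sub unfolding in_U_def homogeneous_def by blast
  then obtain g where g: "isom_emb M d M d g" "\<forall>x\<in>p ` F0. g x = k x" by blast
  have gM: "g x \<in> M" if "x \<in> M" for x using g(1) that by (auto simp: isom_emb_def)
  have ge: "d (g x) (g y) = d x y" if "x \<in> M" "y \<in> M" for x y
    using g(1) that by (auto simp: isom_emb_def)
  have "isom_emb F e M d (g \<circ> p)"
    unfolding isom_emb_def by (auto simp: gM pM ge pe)
  moreover have "\<forall>x\<in>F0. (g \<circ> p) x = q x" using g(2) kp F0(1) by auto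
  ultimately show ?thesis by blast
qed

text \<open>Since \<open>in_U\<close> tests only metrics on sets of naturals, \<open>F\<close> is
  coded as \<open>{..<m}\<close> and the number \<open>m\<close> plays the new point.\<close>

lemma in_U_extension:
  fixes f :: "'a \<Rightarrow> real"
  assumes U: "in_U D M d" and F: "finite F" "F \<subseteq> M"
    and fD: "\<And>x. x \<in> F \<Longrightarrow> f x \<in> D \<and> 0 < f x"
    and f: "\<And>x y. x \<in> F \<Longrightarrow> y \<in> F \<Longrightarrow> f x \<le> f y + d x y \<and> d x y \<le> f x + f y"
    and D0: "0 \<in> D"
  shows "\<exists>z\<in>M. \<forall>x\<in>F. d z x = f x"
proof -
  define m where "m = card F"
  obtain h where h: "bij_betw h F {0..<m}" using ex_bij_betw_finite_nat[OF F(1)] m_def by blast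
  define q where "q = inv_into F h"
  have hF: "h x < m" "q (h x) = x" if "x \<in> F" for x
    using h that by (auto simp: q_def bij_betw_def)
  have qF: "q i \<in> F" "h (q i) = i" if "i < m" for i
  proof -
    have "i \<in> h ` F" using h that by (simp add: bij_betw_def)
    then show "q i \<in> F" "h (q i) = i" unfolding q_def by (rule inv_into_into, rule f_inv_into_f)
  qed
  have met: "metric_on M d" and DM: "dist_set M d = D" using U unfolding in_U_def by blast+
  have d: "0 \<le> d x y" "d x y = 0 \<longleftrightarrow> x = y" "d x y = d y x" if "x \<in> F" "y \<in> F" for x y
    using that F(2) by (intro metric_onD[OF met]; blast)+
  have tri: "d x z \<le> d x y + d y z" if "x \<in> F" "y \<in> F" "z \<in> F" for x y z
    using metric_onD(4)[OF met] that F(2) by blast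
  define e where "e i j = (if i = j then 0 else if i = m then f (q j) else if j = m then f (q i)
    else d (q i) (q j))" for i j
  have e1: "e i j = d (q i) (q j)" if "i < m" "j < m" for i j
    using that d(2)[of "q i" "q i"] qF by (auto simp: e_def)
  have e2: "e i m = f (q i)" "e m i = f (q i)" if "i < m" for i
    using that by (auto simp: e_def)
  have emm: "e m m = 0" by (simp add: e_def)
  have qq: "q i = q j \<longleftrightarrow> i = j" if "i < m" "j < m" for i j using qF that by metis
  have lm: "i \<in> {..m} \<longleftrightarrow> i < m \<or> i = m" for i by auto
  have fq: "0 < f (q i)" "f (q i) \<in> D" if "i < m" for i using fD qF that by blast+
  have "metric_on {..m} e"
    unfolding metric_on_def
  proof (rule conjI; intro ballI)
    fix i j assume "i \<in> {..m}" "j \<in> {..m}"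
    then have "i < m \<or> i = m" "j < m \<or> j = m" by auto
    then show "0 \<le> e i j \<and> (e i j = 0) = (i = j) \<and> e i j = e j i"
    proof (elim disjE)
      assume ij: "i < m" "j < m"
      then show ?thesis using d[OF qF(1)[OF ij(1)] qF(1)[OF ij(2)]] qq[OF ij] e1 by metis
    next
      assume "i < m" "j = m" then show ?thesis using fq[of i] by (simp add: e2)
    next
      assume "i = m" "j < m" then show ?thesis using fq[of j] by (simp add: e2)
    next
      assume "i = m" "j = m" then show ?thesis by (simp add: emm)
    qed
  next
    fix i j k assume "i \<in> {..m}" "j \<in> {..m}" "k \<in> {..m}"
    then have "i < m \<or> i = m" and jm: "j < m \<or> j = m" and "k < m \<or> k = m" by auto
    then consider "i < m" "j < m" "k < m" | "i = m" "j < m" "k < m" | "i < m" "j = m" "k < m"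
      | "i < m" "j < m" "k = m" | "i = m" "j = m" | "i = m" "k = m" | "j = m" "k = m" by metis
    then show "e i k \<le> e i j + e j k"
    proof cases
      case 1 then show ?thesis using tri[of "q i" "q j" "q k"] qF by (simp add: e1)
    next
      case 2 then show ?thesis using f[of "q k" "q j"] d(3)[of "q k" "q j"] qF by (simp add: e1 e2)
    next
      case 3 then show ?thesis using f[of "q i" "q k"] qF by (simp add: e1 e2)
    next
      case 4 then show ?thesis using f[of "q i" "q j"] qF by (simp add: e1 e2)
    next
      case 5 then show ?thesis by (simp add: emm)
    next
      case 6
      have "0 \<le> e m j" "0 \<le> e j m"
        using jm fq[of j] by (auto simp: e2 emm)
      then show ?thesis using 6 by (simp add: emm)
    next
      case 7 then show ?thesis by (simp add: emm)
    qed
  qed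
  moreover have "dist_set {..m} e \<subseteq> D"
  proof -
    have "d (q i) (q j) \<in> D" if "i < m" "j < m" for i j
      using DM qF that F(2) unfolding dist_set_def by blast
    then have "e i j \<in> D" if "i \<in> {..m}" "j \<in> {..m}" for i j
      using fq D0 that unfolding lm by (auto simp: e1 e2 emm)
    then show ?thesis unfolding dist_set_def by blast
  qed
  moreover have "isom_emb {..<m} e M d q" using qF F(2) e1 unfolding isom_emb_def by auto
  moreover have "finite {..m}" "{..<m} \<subseteq> {..m}" by auto
  ultimately obtain p where p: "isom_emb {..m} e M d p" "\<forall>x\<in>{..<m}. p x = q x"
    using in_U_extend_embedding[OF U] by metis
  have "d (p m) x = f x" if "x \<in> F" for x
  proof -
    have "d (p m) (p (h x)) = e m (h x)" using p(1) hF[OF that] unfolding isom_emb_def by auto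
    then show ?thesis using hF[OF that] p(2) e2 by auto
  qed
  moreover have "p m \<in> M" using p(1) unfolding isom_emb_def by auto
  ultimately show ?thesis by blast
qed

lemma metric_on_triple:
  assumes e: "e x x = 0" "e y y = 0" "e z z = 0" "e x y = a" "e y x = a" "e y z = b" "e z y = b"
      "e x z = c" "e z x = c"
    and ne: "x \<noteq> y" "y \<noteq> z" "x \<noteq> z"
    and ineq: "0 < a" "0 < b" "0 < c" "a \<le> b + c" "b \<le> a + c" "c \<le> a + b"
  shows "metric_on {x, y, z} e \<and> dist_set {x, y, z} e \<subseteq> {0, a, b, c}"
proof
  show "metric_on {x, y, z} e"
    unfolding metric_on_def ball_simps using ineq ne by (simp only: e) auto
  show "dist_set {x, y, z} e \<subseteq> {0, a, b, c}"
    unfolding dist_set_def by (auto simp: e)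
qed

text \<open>Triangles with sides \<open>a\<close>, \<open>b\<close>, \<open>s\<close> and
  \<open>s\<close>, \<open>c\<close>, \<open>t\<close> are glued along \<open>s\<close> inside
  \<open>M\<close>; \<open>e\<close> is the distance of the two vertices opposite that side. If one
  of \<open>a\<close>, \<open>b\<close>, \<open>c\<close> is 0, a triangle degenerates and
  \<open>e\<close> is one of the given distances.\<close>

lemma in_U_amalgam:
  assumes U: "in_U D M d" and D: "D \<subseteq> {0..}" "0 \<in> D"
    and abc: "a \<in> D" "b \<in> D" "c \<in> D" "s \<in> D" "t \<in> D"
    and s: "a \<le> s" "b \<le> s" "s \<le> a + b" and t: "s \<le> t" "c \<le> t" "t \<le> s + c"
  shows "\<exists>e\<in>D. e \<le> b + c \<and> t \<le> a + e"
proof -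
  have pos: "0 \<le> a" "0 \<le> b" "0 \<le> c" using abc D by auto
  consider "a = 0" | "b = 0" | "c = 0" | "0 < a" "0 < b" "0 < c" using pos by linarith
  then show ?thesis
  proof cases
    case 1 then show ?thesis using abc s t by (intro bexI[of _ t]) auto
  next
    case 2 then show ?thesis using abc s t by (intro bexI[of _ c]) auto
  next
    case 3 then show ?thesis using abc s t by (intro bexI[of _ b]) auto
  next
    case 4
    \<comment> \<open>The triangles live on 0, 1, 2 and 0, 2, 3, with common side \<open>s\<close>
      between 0 and 2.\<close>
    define e1 where "e1 i j = (if i = j then 0 else if i \<noteq> 2 \<and> j \<noteq> 2 then a
      else if i \<noteq> 0 \<and> j \<noteq> 0 then b else s)" for i j :: nat
    define e2 where "e2 i j = (if i = j then 0 else if i \<noteq> 3 \<and> j \<noteq> 3 then s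
      else if i \<noteq> 0 \<and> j \<noteq> 0 then c else t)" for i j :: nat
    have "metric_on {0, 1, 2} e1 \<and> dist_set {0, 1, 2} e1 \<subseteq> {0, a, b, s}"
      by (rule metric_on_triple) (use 4 s in \<open>simp_all add: e1_def\<close>)
    moreover have "{0, a, b, s} \<subseteq> D" using abc D by simp
    ultimately have "metric_on {0, 1, 2} e1" "dist_set {0, 1, 2} e1 \<subseteq> D" by blast+
    moreover have "finite {0, 1, 2::nat}" by simp
    ultimately obtain p where p: "isom_emb {0, 1, 2} e1 M d p" using U unfolding in_U_def by blast
    have pd: "d (p i) (p j) = e1 i j" "p i \<in> M" if "i \<in> {0, 1, 2}" "j \<in> {0, 1, 2}" for i j
      using p that unfolding isom_emb_def by blast+
    have "metric_on {0, 2, 3} e2 \<and> dist_set {0, 2, 3} e2 \<subseteq> {0, s, c, t}"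
      by (rule metric_on_triple) (use 4 s t in \<open>simp_all add: e2_def\<close>)
    moreover have "{0, s, c, t} \<subseteq> D" using abc D by simp
    ultimately have "metric_on {0, 2, 3} e2" "dist_set {0, 2, 3} e2 \<subseteq> D" by blast+
    moreover have "isom_emb {0, 2} e2 M d p"
      unfolding isom_emb_def using pd pd(2)[of _ 0] by (simp add: e1_def e2_def)
    moreover have "finite {0, 2, 3::nat}" "{0, 2} \<subseteq> {0, 2, 3::nat}" by auto
    ultimately have "\<exists>r. isom_emb {0, 2, 3} e2 M d r \<and> (\<forall>x\<in>{0, 2}. r x = p x)"
      using in_U_extend_embedding[OF U] by presburger
    then obtain r where r: "isom_emb {0, 2, 3} e2 M d r" "\<forall>x\<in>{0, 2}. r x = p x" by blast
    have rd: "d (r i) (r j) = e2 i j" "r i \<in> M" if "i \<in> {0, 2, 3}" "j \<in> {0, 2, 3}" for i j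
      using r(1) that unfolding isom_emb_def by blast+
    have rp: "r 0 = p 0" "r 2 = p 2" using r(2) by auto
    have M: "p 0 \<in> M" "p 1 \<in> M" "p 2 \<in> M" "r 3 \<in> M" using pd(2)[of _ 0] rd(2)[of 3 3] by auto
    have d1: "d (p 0) (p 1) = a" "d (p 1) (p 2) = b"
      using pd(1)[of 0 1] pd(1)[of 1 2] by (simp_all add: e1_def)
    have d2: "d (p 2) (r 3) = c" "d (p 0) (r 3) = t"
      using rd(1)[of 2 3] rd(1)[of 0 3] by (simp_all add: e2_def rp)
    have met: "metric_on M d" and DM: "dist_set M d = D" using U unfolding in_U_def by blast+
    have tri: "d x z \<le> d x y + d y z" if "x \<in> M" "y \<in> M" "z \<in> M" for x y z
      using metric_onD(4)[OF met] that by blast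
    have "d (p 1) (r 3) \<le> b + c" "t \<le> a + d (p 1) (r 3)"
      using tri[OF M(2,3,4)] tri[OF M(1,2,4)] unfolding d1 d2 by blast+
    moreover have "d (p 1) (r 3) \<in> D" using DM M unfolding dist_set_def by blast
    ultimately show ?thesis by blast
  qed
qed

section \<open>Passage from real distances to ranks\<close>

theorem theorem8p1:
  fixes D :: "real set" and M :: "'a set" and d :: "'a \<Rightarrow> 'a \<Rightarrow> real"
  assumes "finite D" and "D \<subseteq> {0..}" and "0 \<in> D"
    and "universal D"
    and "is_block D (D - {0})"
    and "in_U D M d"
  shows "indivisible M d"
proof -
  note U = assms(6)
  have met: "metric_on M d" and DM: "dist_set M d = D" and cM: "countable M"
    using U unfolding in_U_def by blast+
  have M0: "M \<noteq> {}" using DM assms(3) unfolding dist_set_def by auto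
  have dD: "d x y \<in> D" if "x \<in> M" "y \<in> M" for x y using DM that unfolding dist_set_def by blast
  define n where "n = card D - 1"
  \<comment> \<open>The increasing enumeration of \<open>D\<close>, with inverse
    \<open>ix\<close>.\<close>
  define v where "v i = sorted_list_of_set D ! i" for i
  have cD: "card D = Suc n" using assms(1,3) 
    using card_gt_0_iff[of D] by (auto simp: n_def)
  have vD: "v i \<in> D" if "i \<le> n" for i
    using nth_mem[of i "sorted_list_of_set D"] that cD assms(1) by (simp add: v_def)
  have v_less: "v i < v j" if "i < j" "j \<le> n" for i j
    using sorted_wrt_nth_less[OF strict_sorted_list_of_set[of D]] that cD by (simp add: v_def)
  have v_le: "v i \<le> v j \<longleftrightarrow> i \<le> j" if "i \<le> n" "j \<le> n" for i j
    using v_less[of i j] v_less[of j i] that by (cases i j rule: linorder_cases) auto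
  have v_ex: "\<exists>i\<le>n. v i = r" if "r \<in> D" for r
    using that assms(1) cD in_set_conv_nth[of r "sorted_list_of_set D"]
    by (auto simp: v_def less_Suc_eq_le)
  define ix where "ix r = inv_into {..n} v r" for r
  have v_ix: "v (ix r) = r" "ix r \<le> n" if "r \<in> D" for r
  proof -
    have "r \<in> v ` {..n}" using v_ex[OF that] by auto
    from f_inv_into_f[OF this] inv_into_into[OF this] show "v (ix r) = r" "ix r \<le> n"
      by (simp_all add: ix_def)
  qed
  have v0: "v 0 = 0"
  proof -
    obtain i where i: "i \<le> n" "v i = 0" using v_ex assms(3) by blast
    then have "v 0 \<le> 0" using v_le[of 0 i] by simp
    then show ?thesis using vD[of 0] assms(2) by auto
  qed
  have v_nn: "0 \<le> v i" if "i \<le> n" for i using v_le[of 0 i] v0 that by simp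
  \<comment> \<open>The truncated sum on ranks; \<open>v\<close> is meaningful only up to
    \<open>n\<close>, hence the cap on both arguments.\<close>
  define pl where "pl i j = Max {k. k \<le> n \<and> v k \<le> v (min i n) + v (min j n)}" for i j
  have pl_in: "pl i j \<le> n \<and> v (pl i j) \<le> v (min i n) + v (min j n)" for i j
  proof -
    have "0 \<in> {k. k \<le> n \<and> v k \<le> v (min i n) + v (min j n)}" using v_nn v0 by simp
    then have "pl i j \<in> {k. k \<le> n \<and> v k \<le> v (min i n) + v (min j n)}"
      unfolding pl_def by (intro Max_in) (auto intro: finite_subset[of _ "{..n}"])
    then show ?thesis by simp
  qed
  have le_pl: "k \<le> pl i j \<longleftrightarrow> v k \<le> v (min i n) + v (min j n)" if "k \<le> n" for i j k
  proof
    assume "k \<le> pl i j"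
    then show "v k \<le> v (min i n) + v (min j n)" using pl_in[of i j] v_le[of k "pl i j"] that by simp
  next
    assume "v k \<le> v (min i n) + v (min j n)"
    then show "k \<le> pl i j" unfolding pl_def
      using that by (intro Max_ge) (auto intro: finite_subset[of _ "{..n}"])
  qed
  have comm: "pl i j = pl j i" for i j by (simp add: pl_def add.commute)
  \<comment> \<open>Amalgamation gives \<open>r\<close> in \<open>D\<close> with
    \<open>r \<le> b + c\<close>, so \<open>r\<close> is at most the truncated sum of
    \<open>b\<close> and \<open>c\<close>, while \<open>t \<le> a + r\<close>. The reverse
    inequality follows by commutativity.\<close>
  have assoc_le: "pl (pl i j) k \<le> pl i (pl j k)" for i j k
  proof -
    have mn: "min (pl i j) n = pl i j" "min (pl j k) n = pl j k" for i j k using pl_in by auto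
    define a b c s t where "a = v (min i n)" "b = v (min j n)" "c = v (min k n)"
      "s = v (pl i j)" "t = v (pl (pl i j) k)"
    note defs = this
    have "a \<le> s" "b \<le> s" "s \<le> t" "c \<le> t"
      unfolding defs using le_pl[of "min i n" i j] le_pl[of "min j n" i j]
        le_pl[of "pl i j" "pl i j" k] le_pl[of "min k n" "pl i j" k] v_nn pl_in v_le
      by (simp_all add: mn)
    moreover have "s \<le> a + b" "t \<le> s + c" unfolding defs using pl_in by (metis mn)+
    moreover have "a \<in> D" "b \<in> D" "c \<in> D" "s \<in> D" "t \<in> D" unfolding defs using vD pl_in by auto
    ultimately obtain r where r: "r \<in> D" "r \<le> b + c" "t \<le> a + r"
      using in_U_amalgam[OF U assms(2,3)] by blast
    obtain l where l: "l \<le> n" "v l = r" using v_ex r by blast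
    then have "l \<le> pl j k" using le_pl r(2) by (simp add: defs)
    then have "r \<le> v (pl j k)" using l v_le pl_in by metis
    then have "t \<le> a + v (min (pl j k) n)" using r mn by simp
    then show ?thesis using le_pl pl_in by (simp add: defs)
  qed
  have assoc: "pl (pl i j) k = pl i (pl j k)" for i j k
    using assoc_le[of i j k] assoc_le[of k j i] by (simp add: comm)
  have n1: "1 \<le> n"
  proof (rule ccontr)
    assume "\<not> 1 \<le> n"
    then have "D = {0}" using cD assms(3) by (metis Suc_leI card_1_singletonE not_gr_zero One_nat_def singletonD)
    then show False using assms(5) by (simp add: is_block_def)
  qed
  have v_pos: "0 < v i" if "1 \<le> i" "i \<le> n" for i using v_less[of 0 i] v0 that by simp
  have MinD: "Min (D - {0}) = v 1"
  proof (rule Min_eqI)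
    fix r assume "r \<in> D - {0}"
    then obtain i where "i \<le> n" "r = v i" "i \<noteq> 0" using v_ex v0 by (metis DiffE singletonI)
    then show "v 1 \<le> r" using v_le[of 1 i] n1 by simp
  qed (use assms(1) vD[OF n1] v_pos[of 1] n1 in auto)
  \<comment> \<open>The block condition speaks of nonzero distances, so index 0 is treated apart,
    using \<open>v 0 = 0\<close>.\<close>
  have v_Suc: "v (Suc i) \<le> v i + v 1" if i: "i < n" for i
  proof (cases "i = 0")
    case False
    have "v i \<in> D - {0}" using False i vD[of i] v_pos[of i] by auto
    moreover have "v n \<in> D - {0}" using vD[of n] v_pos[of n] n1 by auto
    then have "v n \<le> Max (D - {0})" using assms(1) by (intro Max_ge) auto
    then have "v i \<noteq> Max (D - {0})" using v_less[of i n] i by simp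
    ultimately have "dsucc D (v i) \<le> v i + Min (D - {0})" using assms(5) unfolding is_block_def by blast
    moreover have "dsucc D (v i) = v (Suc i)"
      unfolding dsucc_def
    proof (rule Min_eqI)
      fix r assume "r \<in> {x \<in> D. v i < x}"
      then obtain j where j: "j \<le> n" "r = v j" "v i < v j" using v_ex by blast
      then have "i < j" using v_le[of j i] i by force
      then show "v (Suc i) \<le> r" using v_le[of "Suc i" j] j i by simp
    qed (use assms(1) vD[of "Suc i"] v_less[of i "Suc i"] i in auto)
    ultimately show ?thesis using MinD by simp
  qed (simp add: v0)
  have mM: "d x y = 0 \<longleftrightarrow> x = y" "d x y = d y x" if "x \<in> M" "y \<in> M" for x y
    using metric_onD(2,3)[OF met that] .
  interpret block_space n pl M "\<lambda>x y. ix (d x y)"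
  proof
    show "pl i j = pl j i" for i j by (rule comm)
    show "pl (pl i j) k = pl i (pl j k)" for i j k by (rule assoc)
    show "pl i j \<le> n" for i j using pl_in by blast
    show "pl i j \<le> pl i' j" if "i \<le> i'" for i i' j
    proof -
      have "v (min i n) \<le> v (min i' n)" using v_le that by simp
      then have "v (pl i j) \<le> v (min i' n) + v (min j n)" using pl_in[of i j] by linarith
      then show ?thesis using le_pl pl_in by simp
    qed
    show "pl i 0 = i" if "i \<le> n" for i
    proof (rule antisym)
      show "pl i 0 \<le> i" using pl_in[of i 0] v_le[of "pl i 0" i] that v0 by (simp add: min_absorb1)
      show "i \<le> pl i 0" using le_pl[OF that, of i 0] that v0 by (simp add: min_absorb1)
    qed
    show "Suc i \<le> pl i 1" if "i < n" for i
      using le_pl[of "Suc i" i 1] v_Suc[OF that] that n1 by (simp add: min_absorb1)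
    show "ix (d x y) \<le> n" if "x \<in> M" "y \<in> M" for x y using v_ix dD that by blast
    show "ix (d x y) = 0 \<longleftrightarrow> x = y" if "x \<in> M" "y \<in> M" for x y
      using v_ix[OF dD[OF that]] v0 mM[OF that] v_pos[of "ix (d x y)"] by (cases "ix (d x y)") auto
    show "ix (d x y) = ix (d y x)" if "x \<in> M" "y \<in> M" for x y using mM that by simp
    show "ix (d x z) \<le> pl (ix (d x y)) (ix (d y z))" if "x \<in> M" "y \<in> M" "z \<in> M" for x y z
    proof -
      have "d x z \<le> d x y + d y z" using metric_onD(4)[OF met] that by blast
      then show ?thesis using le_pl v_ix dD that by (simp add: min_absorb1)
    qed
    fix F :: "'a set" and f :: "'a \<Rightarrow> nat"
    assume F: "finite F" "F \<subseteq> M" and f1: "\<And>x. x \<in> F \<Longrightarrow> 1 \<le> f x \<and> f x \<le> n"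
      and f2: "\<And>x y. x \<in> F \<Longrightarrow> y \<in> F \<Longrightarrow> f x \<le> pl (f y) (ix (d x y)) \<and> ix (d x y) \<le> pl (f x) (f y)"
    have "\<exists>z\<in>M. \<forall>x\<in>F. d z x = v (f x)"
    proof (rule in_U_extension[OF U F])
      show "v (f x) \<in> D \<and> 0 < v (f x)" if "x \<in> F" for x using vD v_pos f1[OF that] by blast
      show "v (f x) \<le> v (f y) + d x y \<and> d x y \<le> v (f x) + v (f y)" if "x \<in> F" "y \<in> F" for x y
        using f2[OF that] le_pl f1[OF that(1)] f1[OF that(2)] v_ix[OF dD[of x y]] that F(2)
        by (auto simp: min_absorb1 subset_iff)
    qed (rule assms(3))
    then obtain z where z: "z \<in> M" "\<forall>x\<in>F. d z x = v (f x)" by blast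
    have "ix (d z x) = f x" if "x \<in> F" for x
    proof -
      have "d z x = v (f x)" using z that by blast
      moreover have "d z x \<in> D" using z dD F(2) that by blast
      ultimately have "d z x = v (f x)" "d z x \<in> D" .
      then show ?thesis using v_ix[of "d z x"] f1[OF that] v_le[of "f x" "ix (d z x)"]
          v_le[of "ix (d z x)" "f x"] by simp
    qed
    then show "\<exists>z\<in>M. \<forall>x\<in>F. ix (d z x) = f x" using z by blast
  qed
  show ?thesis
    unfolding indivisible_def
  proof (intro allI impI)
    fix \<chi> :: "'a \<Rightarrow> nat" assume \<chi>: "\<chi> ` M \<subseteq> {0, 1}"
    define \<Gamma> where "\<Gamma> = {x \<in> M. \<chi> x = 0}"
    obtain f where f: "f ` M \<subseteq> \<Gamma> \<or> f ` M \<subseteq> M - \<Gamma>"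
      and iso: "\<forall>x\<in>M. \<forall>y\<in>M. ix (d (f x) (f y)) = ix (d x y)"
      using embedding_dichotomy[of \<Gamma>] cM M0 by (auto simp: \<Gamma>_def)
    have fM: "f ` M \<subseteq> M" using f by (auto simp: \<Gamma>_def)
    have "d (f x) (f y) = d x y" if "x \<in> M" "y \<in> M" for x y
    proof -
      have "f x \<in> M" "f y \<in> M" using fM that by auto
      then show ?thesis using iso that v_ix(1)[OF dD] by metis
    qed
    then have "isom_emb M d M d f" using fM unfolding isom_emb_def by blast
    moreover have "(\<forall>x\<in>M. \<chi> (f x) = 0) \<or> (\<forall>x\<in>M. \<chi> (f x) = 1)"
      using f \<chi> unfolding \<Gamma>_def by blast
    ultimately show "\<exists>i\<in>{0, 1}. \<exists>f. isom_emb M d M d f \<and> (\<forall>x\<in>M. \<chi> (f x) = i)" by blast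
  qed
qed

end
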